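(* Suppose that $\hat{\Sigma}_x[i,j]\neq 0$ for all $i,j\in\{0,\ldots,L-1\}$. Suppose that either $r=1$, or $1<r<\sqrt{L}$ and the second-smallest singular value of the matrix $W$ (constructed from $\hat{\Sigma}_x$ as described in the context) is strictly positive. Then $\hat{\Sigma}_x$ (or any arbitrary element of $\Omega(\hat{\Sigma}_x)$) can be recovered from $P_y$ and $T_y$; specifically, if $X\in\mathbb{C}^{L\times L}$ is Hermitian, positive semidefinite, and satisfies $P_y=\mathcal{P}(X)$ and $T_y=\mathcal{T}(X)$, then $X\in\Omega(\hat{\Sigma}_x)$.
   Context: All indices are in $\{0,\ldots,L-1\}$ and are taken modulo $L$. $\overline{(\cdot)}$ is complex conjugation, $(\cdot)^*$ is conjugate transpose, $\odot$ is the entrywise (Hadamard) product, $\otimes$ is the Kronecker product. Model (complex-valued, noiseless). $x=\sum_{i=1}^r a_i v_i\in\mathbb{C}^L$, where $v_1,\ldots,v_r\in\mathbb{C}^L$ are orthonormal, $a_1,\ldots,a_r$ are independent, $a_i\sim\mathbb{C}\mathcal{N}(0,\lambda_i)$ (circularly-symmetric complex normal with variance $\lambda_i>0$). The observation is $y=R_s\{x\}$, where $R_s\{x\}[\ell]=x[\ell-s]$ is the cyclic shift and $s$ is a random element of $\mathbb{Z}_L$ with an arbitrary distribution, independent of $x$. Let $f_\ell\in\mathbb{C}^L$, $f_\ell[k]=e^{-\imath 2\pi k\ell/L}$, let $F[\ell,k]=\frac{1}{\sqrt{L}}f_\ell[k]$ be the unitary DFT matrix, $\hat{x}=Fx$,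 $\hat{y}=Fy$, $\hat{v}_i=Fv_i$, and $\hat{\Sigma}_x=\mathbb{E}[\hat{x}\hat{x}^*]=\sum_{i=1}^r\lambda_i\hat{v}_i\hat{v}_i^*$ (Hermitian, positive semidefinite, rank $r$). Power spectrum and trispectrum: $P_y[k]=\mathbb{E}\big[\hat{y}[k]\overline{\hat{y}[k]}\big]$ and $T_y[k_1,k_2,k_3]=\mathbb{E}\big[\hat{y}[k_1]\overline{\hat{y}[k_2]}\hat{y}[k_3]\overline{\hat{y}[k_1-k_2+k_3]}\big]$. Maps on $X\in\mathbb{C}^{L\times L}$: $\mathcal{P}(X)[k_1]=X[k_1,k_1]$ and $\mathcal{T}(X)[k_1,k_2,k_3]=X[k_1,k_2]\,\overline{X[k_3-k_2+k_1,k_3]}+X[k_1,k_3-k_2+k_1]\,\overline{X[k_2,k_3]}$. Ambiguity set: $\Omega(\hat{\Sigma}_x)=\{\operatorname{diag}(f_\ell)\,\hat{\Sigma}_x\,\operatorname{diag}(f_\ell^* ):\ \ell=0,\ldots,L-1\}$. Construction of $W$ (for $r<\sqrt L$) from $\hat{\Sigma}_x$. For a matrix $Y$ let $R_{i,j}\{Y\}[k,m]=Y[k-i,m-j]$, and let $H_{i,j}=\hat{\Sigma}_x\odot\overline{R_{i,j}\{\hat{\Sigma}_x\}}$. The matrix $H_{i,i}$ is Hermitian positive semidefinite of rank at most $r^2$; let $V^{(i)}\in\mathbb{C}^{L\times r^2}$ have as columns $r^2$ orthonormal eigenvectors of $H_{i,i}$ corresponding to its $r^2$ largest eigenvalues.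 For a vector $z\in\mathbb{C}^L$, $\operatorname{Circulant}\{z\}[k_1,k_2]=z[\operatorname{mod}(k_2-k_1,L)]$; $\mathbf{e}_m$ is the $m$-th standard basis vector; $\operatorname{vec}$ stacks columns of a matrix. Set $Z^{(i)}=\overline{V^{(i+1)}}\otimes V^{(i)}\in\mathbb{C}^{L^2\times r^4}$ and $M^{(i)}_m=\operatorname{vec}\{H_{i,i+1}\}\odot\operatorname{vec}\{\operatorname{Circulant}\{\mathbf{e}_m\}\}\in\mathbb{C}^{L^2}$. Then $W\in\mathbb{C}^{L^3\times(L+r^4L)}$ is $W=[\,M\;\;-\operatorname{BlockDiag}\{Z^{(0)},\ldots,Z^{(L-1)}\}\,]$, where $M\in\mathbb{C}^{L^3\times L}$ is the block matrix whose $(i,m)$ block (block row $i$, column $m$) is $M^{(i)}_m$. Singular values are counted with multiplicity. *)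

theory Defs
  imports
    "HOL-Probability.Probability"
    "Jordan_Normal_Form.Schur_Decomposition"
begin

unbundle no vec_syntax
text \<open>Vectors and matrices are 0-based and carry their dimension at run time; the entries
  below accept arbitrary integer indices, which are read modulo the dimension.\<close>

definition vec_at :: "'a vec \<Rightarrow> int \<Rightarrow> 'a" where
  "vec_at x k = x $ nat (k mod int (dim_vec x))"

definition mat_at :: "'a mat \<Rightarrow> int \<Rightarrow> int \<Rightarrow> 'a" where
  "mat_at A k m = A $$ (nat (k mod int (dim_row A)), nat (m mod int (dim_col A)))"

definition cyclic_shift :: "nat \<Rightarrow> 'a vec \<Rightarrow> 'a vec" where
  "cyclic_shift s x = Matrix.vec (dim_vec x) (\<lambda>l. vec_at x (int l - int s))"

definition cyclic_shift_mat :: "int \<Rightarrow> int \<Rightarrow> 'a mat \<Rightarrow> 'a mat" where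
  "cyclic_shift_mat i j A =
     Matrix.mat (dim_row A) (dim_col A) (\<lambda>(k, m). mat_at A (int k - i) (int m - j))"

definition fourier_vec :: "nat \<Rightarrow> nat \<Rightarrow> complex vec" where
  "fourier_vec L l =
     Matrix.vec L (\<lambda>k. exp (- (\<i> * complex_of_real (2 * pi * real k * real l / real L))))"

definition dft_mat :: "nat \<Rightarrow> complex mat" where
  "dft_mat L = Matrix.mat L L (\<lambda>(l, k). complex_of_real (1 / sqrt (real L)) * fourier_vec L l $ k)"

definition dft :: "complex vec \<Rightarrow> complex vec" where
  "dft x = dft_mat (dim_vec x) *\<^sub>v x"

definition circ_complex_normal :: "'w measure \<Rightarrow> real \<Rightarrow> ('w \<Rightarrow> complex) \<Rightarrow> bool" where
  "circ_complex_normal M v Z \<longleftrightarrow>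
     prob_space.indep_var M borel (\<lambda>\<omega>. Re (Z \<omega>)) borel (\<lambda>\<omega>. Im (Z \<omega>)) \<and>
     distributed M lborel (\<lambda>\<omega>. Re (Z \<omega>)) (\<lambda>t. ennreal (normal_density 0 (sqrt (v / 2)) t)) \<and>
     distributed M lborel (\<lambda>\<omega>. Im (Z \<omega>)) (\<lambda>t. ennreal (normal_density 0 (sqrt (v / 2)) t))"

text \<open>Independence of two random variables whose value types may differ, which
  \<^const>\<open>prob_space.indep_var\<close> does not cover.\<close>

definition independent_rvs ::
  "'w measure \<Rightarrow> 'b measure \<Rightarrow> ('w \<Rightarrow> 'b) \<Rightarrow> 'c measure \<Rightarrow> ('w \<Rightarrow> 'c) \<Rightarrow> bool" where
  "independent_rvs M N\<^sub>1 X N\<^sub>2 Y \<longleftrightarrow>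
     X \<in> measurable M N\<^sub>1 \<and> Y \<in> measurable M N\<^sub>2 \<and>
     prob_space.indep_set M {X -` A \<inter> space M | A. A \<in> sets N\<^sub>1} {Y -` B \<inter> space M | B. B \<in> sets N\<^sub>2}"

definition covariance_dft :: "'w measure \<Rightarrow> nat \<Rightarrow> ('w \<Rightarrow> complex vec) \<Rightarrow> complex mat" where
  "covariance_dft M L x =
     Matrix.mat L L (\<lambda>(k, m). \<integral>\<omega>. dft (x \<omega>) $ k * cnj (dft (x \<omega>) $ m) \<partial>M)"

definition power_spectrum :: "'w measure \<Rightarrow> ('w \<Rightarrow> complex vec) \<Rightarrow> int \<Rightarrow> complex" where
  "power_spectrum M y k = (\<integral>\<omega>. vec_at (dft (y \<omega>)) k * cnj (vec_at (dft (y \<omega>)) k) \<partial>M)"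

definition trispectrum ::
  "'w measure \<Rightarrow> ('w \<Rightarrow> complex vec) \<Rightarrow> int \<Rightarrow> int \<Rightarrow> int \<Rightarrow> complex" where
  "trispectrum M y k1 k2 k3 =
     (\<integral>\<omega>. vec_at (dft (y \<omega>)) k1 * cnj (vec_at (dft (y \<omega>)) k2) *
          vec_at (dft (y \<omega>)) k3 * cnj (vec_at (dft (y \<omega>)) (k1 - k2 + k3)) \<partial>M)"

definition P_map :: "complex mat \<Rightarrow> int \<Rightarrow> complex" where
  "P_map X k1 = mat_at X k1 k1"

definition T_map :: "complex mat \<Rightarrow> int \<Rightarrow> int \<Rightarrow> int \<Rightarrow> complex" where
  "T_map X k1 k2 k3 =
     mat_at X k1 k2 * cnj (mat_at X (k3 - k2 + k1) k3) +
     mat_at X k1 (k3 - k2 + k1) * cnj (mat_at X k2 k3)"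

definition ambiguity_set :: "complex mat \<Rightarrow> complex mat set" where
  "ambiguity_set S = (let L = dim_row S in
     {mat_diag L (\<lambda>k. fourier_vec L l $ k) * S * mat_diag L (\<lambda>k. cnj (fourier_vec L l $ k)) | l.
      l < L})"

definition hermitian_mat :: "complex mat \<Rightarrow> bool" where
  "hermitian_mat A \<longleftrightarrow> mat_adjoint A = A"

text \<open>Since \<open>u \<bullet>c z\<close> conjugates its second argument, the quadratic form below is
  the usual \<open>z\<^sup>* A z\<close>; it is real for Hermitian \<open>A\<close>.\<close>

definition psd_mat :: "complex mat \<Rightarrow> bool" where
  "psd_mat A \<longleftrightarrow> hermitian_mat A \<and> (\<forall>z \<in> carrier_vec (dim_row A). 0 \<le> Re ((A *\<^sub>v z) \<bullet>c z))"

definition hadamard_vec :: "'a :: times vec \<Rightarrow> 'a vec \<Rightarrow> 'a vec" where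
  "hadamard_vec u w = Matrix.vec (dim_vec u) (\<lambda>k. u $ k * w $ k)"

definition hadamard_mat :: "'a :: times mat \<Rightarrow> 'a mat \<Rightarrow> 'a mat" where
  "hadamard_mat A B = Matrix.mat (dim_row A) (dim_col A) (\<lambda>(k, m). A $$ (k, m) * B $$ (k, m))"

definition kronecker_mat :: "'a :: times mat \<Rightarrow> 'a mat \<Rightarrow> 'a mat" where
  "kronecker_mat A B = Matrix.mat (dim_row A * dim_row B) (dim_col A * dim_col B)
     (\<lambda>(p, q). A $$ (p div dim_row B, q div dim_col B) * B $$ (p mod dim_row B, q mod dim_col B))"

definition vec_of_mat :: "'a mat \<Rightarrow> 'a vec" where
  "vec_of_mat A =
     Matrix.vec (dim_row A * dim_col A) (\<lambda>p. A $$ (p mod dim_row A, p div dim_row A))"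

definition circulant :: "'a vec \<Rightarrow> 'a mat" where
  "circulant z = Matrix.mat (dim_vec z) (dim_vec z) (\<lambda>(k1, k2). vec_at z (int k2 - int k1))"

definition hcat_mat :: "'a :: zero mat \<Rightarrow> 'a mat \<Rightarrow> 'a mat" where
  "hcat_mat A B = four_block_mat A B (0\<^sub>m 0 (dim_col A)) (0\<^sub>m 0 (dim_col B))"

text \<open>Eigenvalues of a matrix whose spectrum is real, with algebraic multiplicity and in
  ascending order.\<close>

definition real_eigenvalues :: "complex mat \<Rightarrow> real list" where
  "real_eigenvalues A = sorted_list_of_multiset (image_mset Re (proots (char_poly A)))"

text \<open>An \<open>m \<times> n\<close> matrix has \<open>min m n\<close> singular values, hence the case
  distinction.\<close>

definition singular_values :: "complex mat \<Rightarrow> real list" where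
  "singular_values A = map sqrt (real_eigenvalues
     (if dim_col A \<le> dim_row A then mat_adjoint A * A else A * mat_adjoint A))"

definition second_smallest_singular_value :: "complex mat \<Rightarrow> real" where
  "second_smallest_singular_value A = singular_values A ! 1"

text \<open>The columns of \<open>V\<close> are orthonormal eigenvectors of the Hermitian matrix \<open>A\<close>,
  in any order, for its \<open>n\<close> largest eigenvalues counted with multiplicity.
  Such a \<open>V\<close> is not unique.\<close>

definition top_eigenvectors :: "nat \<Rightarrow> complex mat \<Rightarrow> complex mat \<Rightarrow> bool" where
  "top_eigenvectors n A V \<longleftrightarrow>
     V \<in> carrier_mat (dim_row A) n \<and>
     (\<forall>i<n. \<forall>j<n. col V i \<bullet>c col V j = (if i = j then 1 else 0)) \<and>
     (\<exists>d. length d = n \<and> mset d = mset (take n (rev (real_eigenvalues A))) \<and>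
          (\<forall>j<n. A *\<^sub>v col V j = complex_of_real (d ! j) \<cdot>\<^sub>v col V j))"

definition H_mat :: "complex mat \<Rightarrow> int \<Rightarrow> int \<Rightarrow> complex mat" where
  "H_mat S i j = hadamard_mat S (map_mat cnj (cyclic_shift_mat i j S))"

definition Z_mat :: "nat \<Rightarrow> (nat \<Rightarrow> complex mat) \<Rightarrow> nat \<Rightarrow> complex mat" where
  "Z_mat L V i = kronecker_mat (map_mat cnj (V ((i + 1) mod L))) (V i)"

definition M_vec :: "complex mat \<Rightarrow> nat \<Rightarrow> nat \<Rightarrow> complex vec" where
  "M_vec S i m = hadamard_vec (vec_of_mat (H_mat S (int i) (int i + 1)))
     (vec_of_mat (circulant (unit_vec (dim_row S) m)))"

definition M_mat :: "complex mat \<Rightarrow> complex mat" where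
  "M_mat S = (let L = dim_row S in
     Matrix.mat (L ^ 3) L (\<lambda>(p, m). M_vec S (p div L\<^sup>2) m $ (p mod L\<^sup>2)))"

definition W_mat :: "complex mat \<Rightarrow> (nat \<Rightarrow> complex mat) \<Rightarrow> complex mat" where
  "W_mat S V = (let L = dim_row S in
     hcat_mat (M_mat S) (- diag_block_mat (map (Z_mat L V) [0..<L])))"

end

theory Submission
  imports Defs
begin

text \<open>The phase of a shift cancels in every product that enters \<open>P_y\<close> and \<open>T_y\<close>, so Isserlis' formula for
  circular Gaussians shows \<open>P_y\<close> and \<open>T_y\<close> to be the values of the two maps at \<open>S\<close>. If \<open>X\<close> gives the same
  values, then the trispectrum equations force \<open>X[k,m] = c(m - k) S[k,m]\<close> with
  unimodular \<open>c\<close>; positivity plays no role so far. It remains to see that \<open>c\<close> is a character of \<open>Z_L\<close>.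

  For \<open>r = 1\<close> the equality \<open>\<bar>X[0,1]\<bar>\<^sup>2 = X[0,0] X[1,1]\<close> and \<open>X \<ge> 0\<close> give \<open>c(m + 1) = c(1) c(m)\<close>. For \<open>r > 1\<close>
  write \<open>X[k,m] = \<langle>b k, b m\<rangle>\<close>, so that the matrices \<open>H_{i,j}\<close> of \<open>X\<close> are \<open>B_i B_j\<^sup>*\<close>. The
  matrices \<open>H_{i,i}\<close> do not see \<open>c\<close>, hence the range of \<open>B_i\<close> lies in the span of the columns of \<open>V_i\<close>,
  and \<open>H_{i,i+1} = V_i Q_i V_{i+1}\<^sup>*\<close> for some \<open>Q_i\<close>. Therefore \<open>c(m) cnj (c(m - 1))\<close>, completed by
  the entries of the \<open>Q_i\<close>, is a kernel vector of \<open>W\<close>, just as the all-ones vector is, completed by the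
  corresponding matrices of \<open>S\<close>. The kernel is at most one-dimensional, so \<open>c(m) cnj (c(m - 1))\<close> is constant.\<close>

section \<open>Phases and positive semidefinite kernels\<close>

lemma int_constant_if_step:
  fixes u :: "int \<Rightarrow> 'a"
  assumes "\<And>k. u (k + 1) = u k"
  shows "u k = u 0"
proof (induction k rule: int_induct[of _ 0])
  case (step2 i)
  then show ?case using assms[of "i - 1"] by simp
qed (use assms in auto)

text \<open>Multiplying the first hypothesis by \<open>y\<close> produces \<open>y * cnj y\<close>,
  which equals \<open>t * cnj t\<close>, and \<open>cnj t\<close> cancels. The lemma carries a
  quotient of entries of \<open>X\<close> and \<open>S\<close> from one place of a diagonal to the
  next.\<close>

lemma unimodular_quotient_eq:
  fixes x y s t :: complex
  assumes "x * cnj y = s * cnj t" and "cmod y = cmod t" and "s \<noteq> 0" and "t \<noteq> 0"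
  shows "x / s = y / t"
proof -
  have y: "y * cnj y = t * cnj t"
    using assms(2) by (simp add: complex_norm_square [symmetric])
  have "y \<noteq> 0" using assms(2,4) by auto
  have "x * t * cnj t = x * y * cnj y" using y by (simp add: mult.assoc)
  also have "\<dots> = y * (x * cnj y)" by simp
  also have "\<dots> = y * s * cnj t" using assms(1) by simp
  finally have "x * t = y * s" using assms(4) by simp
  then show ?thesis using assms(3,4) by (auto simp: field_simps)
qed

text \<open>Kernels on all integers stand in for matrices with cyclic indices, so that the induction
  along a diagonal never meets a wrap-around. One unknown phase per diagonal is what is left
  afterwards.\<close>

lemma equal_trispectrum_imp_phase_per_diagonal:
  fixes X S :: "int \<Rightarrow> int \<Rightarrow> complex"
  assumes S0: "\<And>k m. S k m \<noteq> 0"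
    and diag: "\<And>k. X k k = S k k"
    and tri: "\<And>k1 k2 k3. X k1 k2 * cnj (X (k3 - k2 + k1) k3) + X k1 (k3 - k2 + k1) * cnj (X k2 k3) =
      S k1 k2 * cnj (S (k3 - k2 + k1) k3) + S k1 (k3 - k2 + k1) * cnj (S k2 k3)"
  defines "c \<equiv> \<lambda>m. X 0 m / S 0 m"
  shows "X k m = c (m - k) * S k m" and "cmod (c m) = 1"
proof -
  have abs: "cmod (X k j) = cmod (S k j)" for k j
  proof -
    have "X k j * cnj (X k j) = S k j * cnj (S k j)"
      using tri[of k k j] diag by simp
    then have "(cmod (X k j))\<^sup>2 = (cmod (S k j))\<^sup>2"
      by (metis complex_norm_square of_real_eq_iff)
    then show ?thesis by simp
  qed
  \<comment> \<open>Choosing \<open>k1 = k2\<close> above turned the second term into \<open>\<bar>X k j\<bar>\<^sup>2\<close>. The two terms also coincide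
    for \<open>k2 = k1 + 1 = k4\<close>, which settles the first off-diagonal; feeding that back into
    \<open>k2 = k1 + 1\<close> with \<open>k3\<close> arbitrary settles every other diagonal.\<close>
  have const: "X k (k + p) / S k (k + p) = X 0 p / S 0 p"
    if h: "\<And>k. X k (k + p) * cnj (X (k + 1) (k + 1 + p)) = S k (k + p) * cnj (S (k + 1) (k + 1 + p))"
    for k p
    using int_constant_if_step[of "\<lambda>k. X k (k + p) / S k (k + p)" k]
      unimodular_quotient_eq[OF h abs S0 S0] by simp
  have one: "X k (k + 1) * cnj (X (k + 1) (k + 1 + 1)) = S k (k + 1) * cnj (S (k + 1) (k + 1 + 1))" for k
    using tri[of k "k + 1" "k + 1 + 1"] by (simp add: algebra_simps)
  have 1: "X k (k + 1) = c 1 * S k (k + 1)" for k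
    using const[OF one, of k] S0[of k "k + 1"] by (simp add: c_def field_simps)
  have c1: "c 1 * cnj (c 1) = 1"
    using abs[of 0 1] S0[of 0 1] by (simp add: c_def norm_divide flip: complex_norm_square)
  have "X k (k + p) * cnj (X (k + 1) (k + 1 + p)) = S k (k + p) * cnj (S (k + 1) (k + 1 + p))" for k p
  proof -
    have "X k (k + 1) * cnj (X (k + p) (k + p + 1)) = c 1 * cnj (c 1) * (S k (k + 1) * cnj (S (k + p) (k + p + 1)))"
      by (simp add: 1)
    then show ?thesis
      using tri[of k "k + 1" "k + 1 + p"] c1 by (simp add: algebra_simps)
  qed
  from const[OF this, of k "m - k"] show "X k m = c (m - k) * S k m"
    using S0[of k m] by (simp add: c_def field_simps)
  show "cmod (c m) = 1" using abs[of 0 m] S0[of 0 m] by (simp add: c_def norm_divide)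
qed

text \<open>Induction on the index set: subtract the rank-one part that clears row \<open>a\<close>
  (a Schur complement) and factor the rest.\<close>

lemma psd_kernel_factorization:
  fixes f :: "'i \<Rightarrow> 'i \<Rightarrow> complex"
  assumes "finite A"
    and "\<And>i j. i \<in> A \<Longrightarrow> j \<in> A \<Longrightarrow> f j i = cnj (f i j)"
    and "\<And>z. 0 \<le> Re (\<Sum>i\<in>A. \<Sum>j\<in>A. cnj (z i) * z j * f i j)"
  shows "\<exists>Y. \<forall>i\<in>A. \<forall>j\<in>A. f i j = (\<Sum>q\<in>A. Y i q * cnj (Y j q))"
  using assms
proof (induction A arbitrary: f rule: finite_induct)
  case (insert a A)
  note herm = insert.prems(1) and psd = insert.prems(2)
  have cross: "(\<Sum>i\<in>insert a A. \<Sum>j\<in>insert a A. cnj (z i) * z j * f i j) =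
     cnj (z a) * z a * f a a + cnj (z a) * (\<Sum>j\<in>A. z j * f a j) + z a * cnj (\<Sum>j\<in>A. z j * f a j) +
     (\<Sum>i\<in>A. \<Sum>j\<in>A. cnj (z i) * z j * f i j)" for z
  proof -
    have "f i a = cnj (f a i)" if "i \<in> A" for i using herm[of a i] that by simp
    then show ?thesis
      using insert.hyps by (simp add: sum.distrib sum_distrib_left algebra_simps)
  qed
  have real_d: "Im (f a a) = 0" using herm[of a a] by (simp add: complex_eq_iff)
  define d where "d = Re (f a a)"
  have faa: "f a a = of_real d" using real_d by (simp add: d_def complex_eq_iff)
  have d0: "0 \<le> d"
  proof -
    let ?z = "\<lambda>i. if i = a then 1 else 0 :: complex"
    have "(\<Sum>j\<in>A. ?z j * f a j) = 0" "(\<Sum>i\<in>A. \<Sum>j\<in>A. cnj (?z i) * ?z j * f i j) = 0"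
      using insert.hyps by (auto intro!: sum.neutral)
    then show ?thesis
      using psd[of ?z] unfolding cross by (simp add: faa)
  qed
  \<comment> \<open>If \<open>d = 0\<close> then division by zero gives \<open>u = 0\<close>, which is the value wanted in that case.\<close>
  define u where "u i = cnj (f a i) / of_real (sqrt d)" for i
  have fa: "f a j = of_real (sqrt d) * cnj (u j)" if j: "j \<in> A" for j
  proof (cases "d = 0")
    case True
    let ?w = "f a j"
    \<comment> \<open>The test vector has entry \<open>1\<close> at \<open>j\<close> and
      \<open>- t\<close> times \<open>?w\<close> at \<open>a\<close>. With \<open>d = 0\<close> the
      form is affine in \<open>t\<close> with slope minus twice the squared modulus of
      \<open>?w\<close>, so it can stay nonnegative only if \<open>?w\<close> vanishes.\<close>
    have *: "0 \<le> - (2 * t * (cmod ?w)\<^sup>2) + Re (f j j)" for t :: real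
    proof -
      let ?z = "\<lambda>i. if i = a then - (of_real t * ?w) else if i = j then 1 else 0"
      have 1: "(\<Sum>i\<in>A. ?z i * f a i) = (\<Sum>i\<in>A. if i = j then f a i else 0)"
        using insert.hyps by (intro sum.cong) auto
      have 2: "(\<Sum>i\<in>A. \<Sum>k\<in>A. cnj (?z i) * ?z k * f i k) = (\<Sum>i\<in>A. if i = j then f i j else 0)"
      proof (intro sum.cong refl)
        fix i assume i: "i \<in> A"
        have "(\<Sum>k\<in>A. cnj (?z i) * ?z k * f i k) =
            (\<Sum>k\<in>A. if k = j then (if i = j then f i k else 0) else 0)"
          using insert.hyps i by (intro sum.cong) auto
        then show "(\<Sum>k\<in>A. cnj (?z i) * ?z k * f i k) = (if i = j then f i j else 0)"
          using insert.hyps j by simp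
      qed
      have "0 \<le> Re (- (of_real t * (cnj ?w * ?w)) - of_real t * (?w * cnj ?w) + f j j)"
        using psd[of ?z] unfolding cross 1 2
        using insert.hyps j by (simp add: faa True sum.delta algebra_simps)
      moreover have "cnj ?w * ?w = of_real ((cmod ?w)\<^sup>2)" "?w * cnj ?w = of_real ((cmod ?w)\<^sup>2)"
        by (simp_all only: complex_norm_square mult.commute)
      ultimately show ?thesis by simp
    qed
    have "(cmod ?w)\<^sup>2 = 0"
    proof (rule ccontr)
      assume "(cmod ?w)\<^sup>2 \<noteq> 0"
      then show False
        using *[of "(Re (f j j) + 1) / (cmod ?w)\<^sup>2"] *[of 0] by simp
    qed
    then show ?thesis by (simp add: True)
  next
    case False
    then show ?thesis using d0 by (simp add: u_def)
  qed
  define g where "g i j = f i j - u i * cnj (u j)" for i j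
  have "\<exists>Y. \<forall>i\<in>A. \<forall>j\<in>A. g i j = (\<Sum>q\<in>A. Y i q * cnj (Y j q))"
  proof (rule insert.IH)
    show "g j i = cnj (g i j)" if "i \<in> A" "j \<in> A" for i j
      using that herm[of i j] by (simp add: g_def)
    show "0 \<le> Re (\<Sum>i\<in>A. \<Sum>j\<in>A. cnj (z i) * z j * g i j)" for z
    proof -
      define w where "w = (\<Sum>j\<in>A. z j * cnj (u j))"
      \<comment> \<open>Completing the square: this entry at \<open>a\<close> makes the form of
        \<open>f\<close> at \<open>z'\<close> equal to the form of \<open>g\<close> at
        \<open>z\<close>. For \<open>d = 0\<close> both \<open>w\<close> and the entry are
        zero.\<close>
      define z' where "z' i = (if i = a then - w / of_real (sqrt d) else z i)" for i
      have z': "z' i = z i" if "i \<in> A" for i using that insert.hyps by (auto simp: z'_def)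
      have 1: "(\<Sum>j\<in>A. z' j * f a j) = of_real (sqrt d) * w"
        unfolding w_def sum_distrib_left by (intro sum.cong) (simp_all add: z' fa)
      have 2: "(\<Sum>i\<in>A. \<Sum>j\<in>A. cnj (z' i) * z' j * f i j) =
          (\<Sum>i\<in>A. \<Sum>j\<in>A. cnj (z i) * z j * f i j)"
        by (intro sum.cong) (simp_all add: z')
      have w0: "d = 0 \<Longrightarrow> w = 0" by (simp add: w_def u_def)
      have e1: "cnj (z' a) * z' a * f a a + cnj (z' a) * (of_real (sqrt d) * w) +
          z' a * cnj (of_real (sqrt d) * w) = - (cnj w * w)"
      proof (cases "d = 0")
        case False
        then have "of_real (sqrt d) \<noteq> (0 :: complex)" by simp
        moreover have "f a a = of_real (sqrt d) * of_real (sqrt d)"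
          using d0 by (simp add: faa flip: of_real_mult)
        ultimately show ?thesis by (simp add: z'_def field_simps)
      qed (simp add: w0 faa)
      have e2: "(\<Sum>i\<in>A. \<Sum>j\<in>A. cnj (z i) * z j * g i j) =
          (\<Sum>i\<in>A. \<Sum>j\<in>A. cnj (z i) * z j * f i j) - cnj w * w"
      proof -
        have "cnj w * w = (\<Sum>i\<in>A. \<Sum>j\<in>A. cnj (z i) * z j * (u i * cnj (u j)))"
          unfolding w_def by (simp add: sum_product mult_ac)
        then show ?thesis by (simp add: g_def sum_subtractf right_diff_distrib)
      qed
      show ?thesis
        using psd[of z'] unfolding cross 1 2 e1 e2 by (simp only: uminus_add_conv_diff)
    qed
  qed
  then obtain Y where Y: "\<And>i j. i \<in> A \<Longrightarrow> j \<in> A \<Longrightarrow> g i j = (\<Sum>q\<in>A. Y i q * cnj (Y j q))"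
    by blast
  \<comment> \<open>Column \<open>a\<close> carries the rank-one part that was subtracted; the other
    columns are the factor of the Schur complement, extended by zero in row
    \<open>a\<close>.\<close>
  define Y' where "Y' i q = (if q = a then if i = a then of_real (sqrt d) else u i
      else if i = a then 0 else Y i q)" for i q
  have "f i j = (\<Sum>q\<in>insert a A. Y' i q * cnj (Y' j q))" if "i \<in> insert a A" "j \<in> insert a A" for i j
  proof -
    have "(\<Sum>q\<in>A. Y' i q * cnj (Y' j q)) =
        (\<Sum>q\<in>A. if i = a \<or> j = a then 0 else Y i q * cnj (Y j q))"
      using insert.hyps by (intro sum.cong refl) (auto simp: Y'_def)
    then have split: "(\<Sum>q\<in>insert a A. Y' i q * cnj (Y' j q)) =
        Y' i a * cnj (Y' j a) + (\<Sum>q\<in>A. if i = a \<or> j = a then 0 else Y i q * cnj (Y j q))"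
      using insert.hyps by simp
    have dd: "f a a = of_real (sqrt d) * of_real (sqrt d)"
      using d0 by (simp add: faa flip: of_real_mult)
    show ?thesis
    proof (cases "i = a \<or> j = a")
      case True
      then show ?thesis
        unfolding split using that fa herm[of a i] by (auto simp: Y'_def dd mult.commute)
    next
      case False
      then show ?thesis
        unfolding split using that Y[of i j] by (simp add: Y'_def g_def algebra_simps)
    qed
  qed
  then show ?case by blast
qed simp

section \<open>Spectra of Gram matrices\<close>

lemma mat_adjoint_dim [simp]: "dim_row (mat_adjoint A) = dim_col A" "dim_col (mat_adjoint A) = dim_row A"
  by (simp_all add: mat_adjoint_def)

lemma mat_adjoint_carrier [simp]: "A \<in> carrier_mat n m \<Longrightarrow> mat_adjoint A \<in> carrier_mat m n"
  by auto

lemma mat_adjoint_index [simp]: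
  fixes A :: "complex mat"
  shows "i < dim_col A \<Longrightarrow> j < dim_row A \<Longrightarrow> mat_adjoint A $$ (i, j) = cnj (A $$ (j, i))"
  by (simp add: mat_adjoint_def mat_of_rows_index)

lemma mat_adjoint_mat_adjoint [simp]: "mat_adjoint (mat_adjoint A) = (A :: complex mat)"
  by (rule eq_matI) auto

lemma cscalar_prod_mat_adjoint:
  fixes A :: "complex mat"
  assumes A: "A \<in> carrier_mat n m" and u: "u \<in> carrier_vec m" and w: "w \<in> carrier_vec n"
  shows "(A *\<^sub>v u) \<bullet>c w = u \<bullet>c (mat_adjoint A *\<^sub>v w)"
proof -
  have "(A *\<^sub>v u) \<bullet>c w = (\<Sum>i<n. \<Sum>j<m. A $$ (i, j) * u $ j * cnj (w $ i))"
    using A u w by (auto simp: scalar_prod_def sum_distrib_right atLeast0LessThan intro!: sum.cong)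
  also have "\<dots> = (\<Sum>j<m. \<Sum>i<n. A $$ (i, j) * u $ j * cnj (w $ i))"
    by (rule sum.swap)
  also have "\<dots> = u \<bullet>c (mat_adjoint A *\<^sub>v w)"
    using A u w by (auto simp: scalar_prod_def sum_distrib_left atLeast0LessThan mult_ac intro!: sum.cong)
  finally show ?thesis .
qed

lemma cscalar_prod_self: "(u :: complex vec) \<bullet>c u = of_real (\<Sum>i<dim_vec u. (cmod (u $ i))\<^sup>2)"
  by (simp add: scalar_prod_def atLeast0LessThan complex_norm_square del: of_real_power)

text \<open>For an eigenvector \<open>u\<close>, moving one factor across the inner product shows
  that \<open>e\<close> times the squared norm of \<open>u\<close> is the squared norm of
  \<open>B u\<close>.\<close>

lemma gram_eigenvalue_nonneg:
  fixes B :: "complex mat"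
  assumes B: "B \<in> carrier_mat n m" and e: "eigenvalue (mat_adjoint B * B) e"
  shows "0 \<le> Re e"
proof -
  obtain u where u: "u \<in> carrier_vec m" "u \<noteq> 0\<^sub>v m" "(mat_adjoint B * B) *\<^sub>v u = e \<cdot>\<^sub>v u"
    using e B by (auto simp: eigenvalue_def eigenvector_def)
  have "e * (u \<bullet>c u) = ((mat_adjoint B * B) *\<^sub>v u) \<bullet>c u"
    using u(1) by (simp add: u(3))
  also have "\<dots> = (mat_adjoint B *\<^sub>v (B *\<^sub>v u)) \<bullet>c u"
    using B u(1) by (subst assoc_mult_mat_vec[of _ m n _ m]) auto
  also have "\<dots> = (B *\<^sub>v u) \<bullet>c (B *\<^sub>v u)"
    using cscalar_prod_mat_adjoint[of "mat_adjoint B" m n "B *\<^sub>v u" u] B u(1) by simp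
  finally have *: "e * of_real (\<Sum>i<m. (cmod (u $ i))\<^sup>2) = of_real (\<Sum>i<n. (cmod ((B *\<^sub>v u) $ i))\<^sup>2)"
    using B u(1) by (simp add: cscalar_prod_self del: of_real_sum)
  have "u \<bullet>c u > 0" using u by (simp add: conjugate_square_greater_0_vec)
  then have pos: "(\<Sum>i<m. (cmod (u $ i))\<^sup>2) > 0" using u(1) by (simp add: cscalar_prod_self less_complex_def)
  have "Re e * (\<Sum>i<m. (cmod (u $ i))\<^sup>2) = (\<Sum>i<n. (cmod ((B *\<^sub>v u) $ i))\<^sup>2)"
    using arg_cong[OF *, of Re] by (simp del: of_real_sum)
  then show ?thesis using pos
    by (metis (no_types, lifting) mult_le_0_iff not_le order_less_imp_le sum_nonneg zero_le_power2 mult_neg_pos)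
qed

text \<open>The diagonal of a Schur form lists the roots of the characteristic polynomial with
  multiplicity. Counting or summing eigenvalues thus becomes counting or summing diagonal entries of
  a triangular matrix.\<close>

lemma schur_form_real_eigenvalues:
  fixes A :: "complex mat"
  assumes A: "A \<in> carrier_mat n n"
  obtains T P Q where "similar_mat_wit A T P Q" "upper_triangular T" "T \<in> carrier_mat n n"
    "mset (real_eigenvalues A) = image_mset (\<lambda>i. Re (T $$ (i, i))) (mset_set {..<n})"
    "\<And>i. i < n \<Longrightarrow> eigenvalue A (T $$ (i, i))"
proof -
  obtain es where es: "char_poly A = (\<Prod>a\<leftarrow>es. [:- a, 1:])"
    using char_poly_factorized[OF A] by blast
  obtain T P Q where TPQ: "schur_decomposition A es = (T, P, Q)" by (metis prod_cases3)
  have sd: "similar_mat_wit A T P Q" "upper_triangular T" "diag_mat T = es"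
    using schur_decomposition[OF A es TPQ] by auto
  have T: "T \<in> carrier_mat n n" using similar_mat_witD2[OF A sd(1)] by simp
  have "proots (char_poly A) = mset es"
    unfolding es
  proof (induction es)
    case (Cons e es)
    have "(\<Prod>a\<leftarrow>es. [:- a, 1:]) \<noteq> 0" by (auto simp: prod_list_zero_iff)
    then have "proots ([:- e, 1:] * (\<Prod>a\<leftarrow>es. [:- a, 1:])) = {#e#} + mset es"
      using Cons.IH by (subst proots_mult) auto
    then show ?case by (simp del: mult_pCons_left)
  qed simp
  moreover have "es = map (\<lambda>i. T $$ (i, i)) [0..<n]" using sd(3) T by (simp add: diag_mat_def)
  ultimately have pr: "proots (char_poly A) = image_mset (\<lambda>i. T $$ (i, i)) (mset_set {..<n})"
    by (metis mset_map mset_upt atLeast0LessThan)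
  show ?thesis
  proof
    show "mset (real_eigenvalues A) = image_mset (\<lambda>i. Re (T $$ (i, i))) (mset_set {..<n})"
      by (simp add: real_eigenvalues_def pr image_mset.compositionality o_def)
    fix i assume "i < n"
    then have root: "T $$ (i, i) \<in># proots (char_poly A)" by (simp add: pr)
    then have "char_poly A \<noteq> 0" by auto
    then show "eigenvalue A (T $$ (i, i))"
      using eigenvalue_root_char_poly[OF A] root by simp
  qed (use sd T in auto)
qed

lemma similar_mat_wit_trace:
  fixes A :: "'a :: comm_ring_1 mat"
  assumes A: "A \<in> carrier_mat n n" and sim: "similar_mat_wit A T P Q"
  shows "(\<Sum>i<n. A $$ (i, i)) = (\<Sum>i<n. T $$ (i, i))"
proof -
  note w = similar_mat_witD2[OF A sim]
  have tr: "(\<Sum>i<n. (C * D) $$ (i, i)) = (\<Sum>i<n. (D * C) $$ (i, i))"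
    if "C \<in> carrier_mat n n" "D \<in> carrier_mat n n" for C D :: "'a mat"
  proof -
    have "(\<Sum>i<n. (C * D) $$ (i, i)) = (\<Sum>i<n. \<Sum>j<n. C $$ (i, j) * D $$ (j, i))"
      using that by (intro sum.cong refl) (simp add: scalar_prod_def atLeast0LessThan)
    also have "\<dots> = (\<Sum>j<n. \<Sum>i<n. C $$ (i, j) * D $$ (j, i))"
      by (rule sum.swap)
    also have "\<dots> = (\<Sum>i<n. (D * C) $$ (i, i))"
      using that by (intro sum.cong refl) (simp add: scalar_prod_def atLeast0LessThan mult.commute)
    finally show ?thesis .
  qed
  have "(\<Sum>i<n. A $$ (i, i)) = (\<Sum>i<n. (P * (T * Q)) $$ (i, i))"
    using w by (simp add: assoc_mult_mat[of P n n T n Q n])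
  also have "\<dots> = (\<Sum>i<n. ((T * Q) * P) $$ (i, i))"
    using w by (intro tr) auto
  also have "(T * Q) * P = T"
    using w by (simp add: assoc_mult_mat[of T n n Q n P n])
  finally show ?thesis .
qed

text \<open>\<open>T\<close> has rank at most \<open>k\<close>. With more than \<open>k\<close>
  nonzero diagonal entries, the corresponding columns of \<open>D\<close> would satisfy a linear
  relation \<open>u\<close>, and so would those columns of \<open>T\<close>. Its row at the last
  index of the support of \<open>u\<close> contradicts triangularity.\<close>

lemma card_nonzero_diag_le:
  fixes T C D :: "complex mat"
  assumes T: "T \<in> carrier_mat n n" and ut: "upper_triangular T"
    and C: "C \<in> carrier_mat n k" and D: "D \<in> carrier_mat k n" and TCD: "T = C * D"
  shows "card {i. i < n \<and> T $$ (i, i) \<noteq> 0} \<le> k"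
proof (rule ccontr)
  define I where "I = {i. i < n \<and> T $$ (i, i) \<noteq> 0}"
  define N where "N = card I"
  assume "\<not> card {i. i < n \<and> T $$ (i, i) \<noteq> 0} \<le> k"
  then have kN: "k < N" by (simp add: N_def I_def)
  have finI: "finite I" by (simp add: I_def)
  obtain h where h: "bij_betw h {..<N} I"
    using ex_bij_betw_nat_finite[OF finI] by (auto simp: N_def atLeast0LessThan)
  have hI: "h j < n" "T $$ (h j, h j) \<noteq> 0" if "j < N" for j
    using bij_betwE[OF h] that by (auto simp: I_def)
  \<comment> \<open>The chosen columns of \<open>D\<close>, padded by zero rows to a square matrix.
    Row \<open>k\<close> belongs to the padding because \<open>k < N\<close>, so the determinant
    vanishes and a kernel vector exists.\<close>
  define E where "E = Matrix.mat N N (\<lambda>(p, j). if p < k then D $$ (p, h j) else 0)"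
  have E: "E \<in> carrier_mat N N" by (simp add: E_def)
  have "(\<Prod>i = 0..<N. E $$ (i, \<pi> i)) = 0" if "\<pi> permutes {0..<N}" for \<pi>
  proof -
    have "\<pi> k < N" using permutes_in_image[OF that, of k] kN by simp
    then show ?thesis using kN by (intro prod_zero) (auto simp: E_def intro!: bexI[of _ k])
  qed
  then have "signof \<pi> * (\<Prod>i = 0..<N. E $$ (i, \<pi> i)) = 0" if "\<pi> permutes {0..<N}" for \<pi>
    using that by simp
  then have "det E = 0" unfolding det_def'[OF E] by (intro sum.neutral) blast
  then obtain u where u: "u \<in> carrier_vec N" "u \<noteq> 0\<^sub>v N" "E *\<^sub>v u = 0\<^sub>v N"
    using det_0_iff_vec_prod_zero[OF E] by auto
  define J where "J = {j. j < N \<and> u $ j \<noteq> 0}"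
  have "J \<noteq> {}" using u(1,2) by (auto simp: J_def vec_eq_iff)
  moreover have finJ: "finite J" by (simp add: J_def)
  \<comment> \<open>The bijection \<open>h\<close> need not be increasing, hence the maximum is
    taken over \<open>h\<close> applied to the support. In row \<open>h j\<close> triangularity
    removes the columns before \<open>h j\<close> and maximality those after it.\<close>
  ultimately have "Max (h ` J) \<in> h ` J" by (intro Max_in) auto
  then obtain j where j: "j \<in> J" "Max (h ` J) = h j" by blast
  have jmax: "h j' \<le> h j" if "j' \<in> J" for j'
    unfolding j(2) [symmetric] using that finJ by (intro Max_ge) auto
  have jN: "j < N" "u $ j \<noteq> 0" using j(1) by (auto simp: J_def)
  have Dz: "(\<Sum>j<N. D $$ (p, h j) * u $ j) = 0" if p: "p < k" for p
  proof -
    have "(\<Sum>j<N. D $$ (p, h j) * u $ j) = (E *\<^sub>v u) $ p"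
      using p kN u(1) by (auto simp: E_def scalar_prod_def atLeast0LessThan)
    then show ?thesis using u(3) p kN by simp
  qed
  have "(\<Sum>j'<N. T $$ (h j, h j') * u $ j') = (\<Sum>j'<N. \<Sum>p<k. C $$ (h j, p) * D $$ (p, h j') * u $ j')"
    using C D hI jN unfolding TCD
    by (intro sum.cong refl) (simp add: scalar_prod_def atLeast0LessThan sum_distrib_right)
  also have "\<dots> = (\<Sum>p<k. C $$ (h j, p) * (\<Sum>j'<N. D $$ (p, h j') * u $ j'))"
    by (subst sum.swap) (simp add: sum_distrib_left mult.assoc)
  also have "\<dots> = 0" by (simp add: Dz)
  also have "(\<Sum>j'<N. T $$ (h j, h j') * u $ j') = (\<Sum>j'<N. if j' = j then T $$ (h j, h j') * u $ j' else 0)"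
  proof (intro sum.cong refl)
    fix j' assume j': "j' \<in> {..<N}"
    have "T $$ (h j, h j') = 0" if "h j' < h j"
      using upper_triangularD[OF ut that] hI(1)[OF jN(1)] T by simp
    moreover have "h j' < h j" if "j' \<in> J" "j' \<noteq> j"
      using jmax[OF that(1)] that j' jN h by (auto simp: bij_betw_def inj_on_def le_less)
    ultimately show "T $$ (h j, h j') * u $ j' = (if j' = j then T $$ (h j, h j') * u $ j' else 0)"
      using j' by (auto simp: J_def)
  qed
  also have "\<dots> = T $$ (h j, h j) * u $ j" using jN(1) by simp
  finally show False using jN hI(2) by simp
qed

text \<open>Back substitution from the last row. At \<open>i0\<close> the diagonal entry may vanish
  and the coordinate is prescribed instead; if \<open>i0\<close> is out of range, all diagonal
  entries are nonzero and nothing is prescribed.\<close>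

lemma upper_triangular_kernel_unique:
  fixes T :: "'a :: idom mat"
  assumes T: "T \<in> carrier_mat n n" and ut: "upper_triangular T"
    and nz: "\<And>i. i < n \<Longrightarrow> i \<noteq> i0 \<Longrightarrow> T $$ (i, i) \<noteq> 0"
    and u: "u \<in> carrier_vec n" "T *\<^sub>v u = 0\<^sub>v n" and u0: "i0 < n \<Longrightarrow> u $ i0 = 0"
  shows "u = 0\<^sub>v n"
proof -
  have "u $ i = 0" if "i < n" for i
    using that
  proof (induction "n - i" arbitrary: i rule: less_induct)
    case less
    show ?case
    proof (cases "i = i0")
      case True
      then show ?thesis using u0 less.prems by simp
    next
      case False
      have "0 = (T *\<^sub>v u) $ i" using less.prems u by simp
      also have "\<dots> = (\<Sum>j<n. T $$ (i, j) * u $ j)"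
        using less.prems T u(1) by (simp add: scalar_prod_def atLeast0LessThan)
      also have "\<dots> = (\<Sum>j<n. if j = i then T $$ (i, j) * u $ j else 0)"
      proof (intro sum.cong refl)
        fix j assume j: "j \<in> {..<n}"
        have "u $ j = 0" if "i < j" using less.hyps[of j] that j by auto
        moreover have "j < i \<or> j = i \<or> i < j" by linarith
        ultimately show "T $$ (i, j) * u $ j = (if j = i then T $$ (i, j) * u $ j else 0)"
          using upper_triangularD[OF ut, of j i] less.prems T j by auto
      qed
      also have "\<dots> = T $$ (i, i) * u $ i" using less.prems by simp
      finally show ?thesis using nz[OF less.prems False] by simp
    qed
  qed
  then show ?thesis using u(1) by (intro eq_vecI) auto
qed

text \<open>At most one eigenvalue of \<open>mat_adjoint A * A\<close> fails to be positive, so its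
  Schur form \<open>T\<close> has at most one zero \<open>i0\<close> on the diagonal. A kernel
  vector \<open>z\<close> is then determined by coordinate \<open>i0\<close> of
  \<open>Q *\<^sub>v z\<close>. The bound \<open>m \<le> n\<close> makes
  \<open>singular_values\<close> refer to this product.\<close>

lemma singular_value_kernel_unique:
  fixes A :: "complex mat"
  assumes A: "A \<in> carrier_mat n m" and mn: "m \<le> n" and m2: "2 \<le> m"
    and pos: "0 < second_smallest_singular_value A"
    and u: "u \<in> carrier_vec m" "A *\<^sub>v u = 0\<^sub>v n" "u \<noteq> 0\<^sub>v m"
    and u': "u' \<in> carrier_vec m" "A *\<^sub>v u' = 0\<^sub>v n"
  shows "\<exists>c. u' = c \<cdot>\<^sub>v u"
proof -
  define N where "N = mat_adjoint A * A"
  have N: "N \<in> carrier_mat m m" unfolding N_def by (rule mult_carrier_mat[OF mat_adjoint_carrier[OF A] A])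
  obtain T P Q where sim: "similar_mat_wit N T P Q" and ut: "upper_triangular T"
    and T: "T \<in> carrier_mat m m"
    and ev: "mset (real_eigenvalues N) = image_mset (\<lambda>i. Re (T $$ (i, i))) (mset_set {..<m})"
    by (rule schur_form_real_eigenvalues[OF N])
  define l where "l = real_eigenvalues N"
  have len: "length l = m"
    using arg_cong[OF ev, of size] by (simp add: l_def)
  have "singular_values A = map sqrt l"
    using A mn by (simp add: singular_values_def l_def N_def)
  then have l1: "0 < l ! 1"
    using pos len m2 by (simp add: second_smallest_singular_value_def)
  have sorted: "sorted l" by (simp add: l_def real_eigenvalues_def)
  obtain a b r where l: "l = a # b # r"
    using len m2 by (metis One_nat_def Suc_le_length_iff numeral_2_eq_2)
  have "size (filter_mset (\<lambda>x. x \<le> 0) (mset l)) \<le> 1"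
  proof -
    have "0 < b" "filter (\<lambda>x. x \<le> 0) r = []"
      using sorted l1 by (auto simp: l filter_empty_conv)
    then show ?thesis by (simp add: l flip: mset_filter)
  qed
  then have "card {i \<in> {..<m}. Re (T $$ (i, i)) \<le> 0} \<le> 1"
    by (simp add: l_def ev filter_mset_image_mset filter_mset_mset_set)
  then have eq: "i = j" if "i < m" "j < m" "Re (T $$ (i, i)) \<le> 0" "Re (T $$ (j, j)) \<le> 0" for i j
    using that by (simp add: card_le_Suc0_iff_eq)
  \<comment> \<open>If no index qualifies, \<open>i0\<close> is arbitrary and may lie beyond
    \<open>m\<close>. That the nonzero vector \<open>u\<close> lies in the kernel shows later that
    \<open>i0 < m\<close>.\<close>
  define i0 where "i0 = (SOME i. i < m \<and> Re (T $$ (i, i)) \<le> 0)"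
  have "i = i0" if "i < m" "Re (T $$ (i, i)) \<le> 0" for i
    using someI[of "\<lambda>i. i < m \<and> Re (T $$ (i, i)) \<le> 0" i] that eq unfolding i0_def by blast
  then have nz: "T $$ (i, i) \<noteq> 0" if "i < m" "i \<noteq> i0" for i
    using that by force
  note w = similar_mat_witD2[OF N sim]
  have ker: "T *\<^sub>v (Q *\<^sub>v z) = 0\<^sub>v m" if z: "z \<in> carrier_vec m" "A *\<^sub>v z = 0\<^sub>v n" for z
  proof -
    have "N *\<^sub>v z = mat_adjoint A *\<^sub>v (A *\<^sub>v z)"
      using A z(1) by (simp add: N_def assoc_mult_mat_vec[of _ m n])
    then have Nz: "N *\<^sub>v z = 0\<^sub>v m" using A z(2) by (auto simp: zero_mat_def)
    have "T *\<^sub>v (Q *\<^sub>v z) = (Q * P) *\<^sub>v (T *\<^sub>v (Q *\<^sub>v z))"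
      using w z by simp
    also have "\<dots> = Q *\<^sub>v (N *\<^sub>v z)"
      using w(5-7) z by (simp add: w(3) assoc_mult_mat_vec[of _ m m _ m])
    finally show ?thesis using w(7) by (auto simp: Nz)
  qed
  have inj: "z = 0\<^sub>v m" if z: "z \<in> carrier_vec m" "Q *\<^sub>v z = 0\<^sub>v m" for z
  proof -
    have "z = (P * Q) *\<^sub>v z" using w z by simp
    also have "\<dots> = P *\<^sub>v (Q *\<^sub>v z)" using w(6,7) z by (simp add: assoc_mult_mat_vec[of _ m m _ m])
    also have "P *\<^sub>v (Q *\<^sub>v z) = 0\<^sub>v m" using w(6) by (auto simp: z(2))
    finally show ?thesis .
  qed
  have van: "z = 0\<^sub>v m" if z: "z \<in> carrier_vec m" "A *\<^sub>v z = 0\<^sub>v n" "i0 < m \<Longrightarrow> (Q *\<^sub>v z) $ i0 = 0" for z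
  proof (rule inj[OF z(1)])
    show "Q *\<^sub>v z = 0\<^sub>v m"
      by (rule upper_triangular_kernel_unique[OF T ut nz mult_mat_vec_carrier[OF w(7) z(1)] ker[OF z(1,2)] z(3)])
  qed
  have i0: "i0 < m" "(Q *\<^sub>v u) $ i0 \<noteq> 0" using van[OF u(1,2)] u(3) by auto
  define c where "c = (Q *\<^sub>v u') $ i0 / (Q *\<^sub>v u) $ i0"
  have "u' - c \<cdot>\<^sub>v u = 0\<^sub>v m"
  proof (rule van)
    show "u' - c \<cdot>\<^sub>v u \<in> carrier_vec m" using u u' by simp
    show "A *\<^sub>v (u' - c \<cdot>\<^sub>v u) = 0\<^sub>v n"
      using A u u' by (intro eq_vecI) (simp_all add: mult_minus_distrib_mat_vec mult_mat_vec)
    show "(Q *\<^sub>v (u' - c \<cdot>\<^sub>v u)) $ i0 = 0" if "i0 < m"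
      using w(7) u u' i0 by (simp add: mult_minus_distrib_mat_vec[of _ m m] mult_mat_vec[of _ m m] c_def)
  qed
  then have "(u' - c \<cdot>\<^sub>v u) $ i = 0" if "i < m" for i
    using that by simp
  then have "u' $ i = c * u $ i" if "i < m" for i
    using that u(1) u'(1) by simp
  then have "u' = c \<cdot>\<^sub>v u" using u(1) u'(1) by (intro eq_vecI) simp_all
  then show ?thesis by blast
qed

text \<open>Pythagoras for the projection onto the span of orthonormal columns: the cross terms and
  the squared norm of the projection all equal the sum of the squared moduli of the coefficients
  \<open>g\<close>.\<close>

lemma bessel_residual:
  fixes V :: "nat \<Rightarrow> nat \<Rightarrow> complex" and w :: "nat \<Rightarrow> complex"
  assumes orth: "\<And>j j'. j < k \<Longrightarrow> j' < k \<Longrightarrow> (\<Sum>i<n. V i j * cnj (V i j')) = (if j = j' then 1 else 0)"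
  defines "g \<equiv> \<lambda>j. \<Sum>i<n. cnj (V i j) * w i"
  shows "(\<Sum>i<n. (cmod (w i - (\<Sum>j<k. V i j * g j)))\<^sup>2) = (\<Sum>i<n. (cmod (w i))\<^sup>2) - (\<Sum>j<k. (cmod (g j))\<^sup>2)"
proof -
  let ?p = "\<lambda>i. \<Sum>j<k. V i j * g j"
  have 1: "(\<Sum>i<n. cnj (w i) * ?p i) = (\<Sum>j<k. g j * cnj (g j))"
  proof -
    have "(\<Sum>i<n. cnj (w i) * ?p i) = (\<Sum>j<k. \<Sum>i<n. g j * (V i j * cnj (w i)))"
      by (subst sum.swap) (simp add: sum_distrib_left mult_ac)
    also have "\<dots> = (\<Sum>j<k. g j * cnj (g j))"
      by (simp add: g_def sum_distrib_left)
    finally show ?thesis .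
  qed
  have 2: "(\<Sum>i<n. ?p i * cnj (?p i)) = (\<Sum>j<k. g j * cnj (g j))"
  proof -
    have "(\<Sum>i<n. ?p i * cnj (?p i)) = (\<Sum>i<n. \<Sum>j<k. \<Sum>j'<k. g j * cnj (g j') * (V i j * cnj (V i j')))"
      by (simp add: sum_product mult_ac)
    also have "\<dots> = (\<Sum>j<k. \<Sum>i<n. \<Sum>j'<k. g j * cnj (g j') * (V i j * cnj (V i j')))"
      by (rule sum.swap)
    also have "\<dots> = (\<Sum>j<k. \<Sum>j'<k. \<Sum>i<n. g j * cnj (g j') * (V i j * cnj (V i j')))"
      by (intro sum.cong refl sum.swap)
    also have "\<dots> = (\<Sum>j<k. \<Sum>j'<k. g j * cnj (g j') * (if j = j' then 1 else 0))"
      by (intro sum.cong refl) (simp add: orth flip: sum_distrib_left)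
    also have "\<dots> = (\<Sum>j<k. g j * cnj (g j))"
      by (simp add: if_distrib sum.delta cong: if_cong)
    finally show ?thesis .
  qed
  have "complex_of_real (\<Sum>i<n. (cmod (w i - ?p i))\<^sup>2) = (\<Sum>i<n. (w i - ?p i) * cnj (w i - ?p i))"
    by (simp add: complex_norm_square del: of_real_power)
  also have "\<dots> = (\<Sum>i<n. w i * cnj (w i)) - cnj (\<Sum>i<n. cnj (w i) * ?p i) - (\<Sum>i<n. cnj (w i) * ?p i)
      + (\<Sum>i<n. ?p i * cnj (?p i))"
    by (simp add: algebra_simps sum.distrib sum_subtractf)
  also have "\<dots> = (\<Sum>i<n. w i * cnj (w i)) - (\<Sum>j<k. g j * cnj (g j))"
    unfolding 1 2 by (simp add: mult.commute)
  also have "\<dots> = complex_of_real ((\<Sum>i<n. (cmod (w i))\<^sup>2) - (\<Sum>j<k. (cmod (g j))\<^sup>2))"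
    by (simp add: complex_norm_square del: of_real_power)
  finally show ?thesis by (simp only: of_real_eq_iff)
qed

text \<open>A nonzero entry after position \<open>k\<close> would be positive, and the
  \<open>k\<close> entries before it at least as large, which makes more than \<open>k\<close>
  nonzero entries. So only zeros are dropped.\<close>

lemma sum_list_take_sorted_desc:
  fixes l :: "real list"
  assumes desc: "sorted (rev l)" and nn: "\<And>x. x \<in> set l \<Longrightarrow> 0 \<le> x"
    and few: "length (filter (\<lambda>x. x \<noteq> 0) l) \<le> k"
  shows "sum_list (take k l) = sum_list l"
proof -
  have "x = 0" if x: "x \<in> set (drop k l)" for x
  proof (rule ccontr)
    assume "x \<noteq> 0"
    then have x0: "0 < x" using nn[of x] in_set_dropD[OF x] by simp
    have kl: "k < length l" using x by (cases "k < length l") auto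
    have "sorted_wrt (\<ge>) (take k l @ drop k l)" using desc by (simp add: sorted_wrt_rev)
    then have "\<forall>y\<in>set (take k l). x \<le> y" using x by (auto simp only: sorted_wrt_append)
    then have "filter (\<lambda>x. x \<noteq> 0) (take k l) = take k l" using x0 by (auto simp: filter_id_conv)
    moreover have "filter (\<lambda>x. x \<noteq> 0) (drop k l) \<noteq> []" using x \<open>x \<noteq> 0\<close> by (auto simp: filter_empty_conv)
    moreover have "filter (\<lambda>x. x \<noteq> 0) l = filter (\<lambda>x. x \<noteq> 0) (take k l) @ filter (\<lambda>x. x \<noteq> 0) (drop k l)"
      by (simp flip: filter_append)
    ultimately have "k < length (filter (\<lambda>x. x \<noteq> 0) l)" using kl by simp
    then show False using few by simp
  qed
  then have "drop k l = replicate (length (drop k l)) 0"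
    by (intro replicate_eqI [OF refl])
  then have "sum_list (drop k l) = 0" by (metis sum_list_replicate mult_zero_right)
  then show ?thesis by (metis append_take_drop_id sum_list_append add.right_neutral)
qed

text \<open>The columns of \<open>V\<close> account for the whole trace of \<open>C C\<^sup>*\<close>, since at most \<open>k\<close> eigenvalues of
  \<open>B B\<^sup>*\<close> are nonzero and none is negative. As \<open>\<parallel>C\<parallel>\<^sup>2 - \<parallel>V\<^sup>* C\<parallel>\<^sup>2 = \<parallel>C - V V\<^sup>* C\<parallel>\<^sup>2\<close> in the Frobenius norm,
  nothing of \<open>C\<close> is left outside the span.\<close>

lemma top_eigenvectors_gram_range:
  fixes B C :: "complex mat"
  assumes B: "B \<in> carrier_mat n k" and C: "C \<in> carrier_mat n p"
    and BC: "C * mat_adjoint C = B * mat_adjoint B"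
    and top: "top_eigenvectors k (B * mat_adjoint B) V"
  shows "V * (mat_adjoint V * C) = C"
proof -
  define H where "H = B * mat_adjoint B"
  have H: "H \<in> carrier_mat n n" using B by (simp add: H_def)
  obtain d where V: "V \<in> carrier_mat n k"
    and orth: "\<And>i j. i < k \<Longrightarrow> j < k \<Longrightarrow> col V i \<bullet>c col V j = (if i = j then 1 else 0)"
    and d: "length d = k" "mset d = mset (take k (rev (real_eigenvalues H)))"
    and eig: "\<And>j. j < k \<Longrightarrow> H *\<^sub>v col V j = complex_of_real (d ! j) \<cdot>\<^sub>v col V j"
    using top H unfolding top_eigenvectors_def H_def [symmetric] by auto
  obtain T P Q where sim: "similar_mat_wit H T P Q" and ut: "upper_triangular T"
    and T: "T \<in> carrier_mat n n"
    and ev: "mset (real_eigenvalues H) = image_mset (\<lambda>i. Re (T $$ (i, i))) (mset_set {..<n})"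
    and Tev: "\<And>i. i < n \<Longrightarrow> eigenvalue H (T $$ (i, i))"
    by (rule schur_form_real_eigenvalues[OF H]) blast
  have nonneg: "0 \<le> Re (T $$ (i, i))" if "i < n" for i
    using gram_eigenvalue_nonneg[of "mat_adjoint B" k n] Tev[OF that] B by (simp add: H_def)
  note w = similar_mat_witD2[OF H sim]
  \<comment> \<open>Since \<open>H\<close> factors through dimension \<open>k\<close>, so does the
    triangular matrix similar to it, and this bounds the number of nonzero eigenvalues.\<close>
  have "T = Q * H * P"
  proof -
    have "T = (Q * P) * T * (Q * P)" unfolding w(2) using w(5) by simp
    also have "\<dots> = Q * (P * T * Q) * P" using w(5-7) by (simp add: assoc_mult_mat[of _ n n _ n _ n])
    finally show ?thesis using w by simp
  qed
  also have "\<dots> = (Q * B) * (mat_adjoint B * P)"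
    using w(6,7) B mat_adjoint_carrier[OF B] mult_carrier_mat[OF mat_adjoint_carrier[OF B] w(6)]
    by (simp add: H_def assoc_mult_mat[of _ n k _ n _ n] assoc_mult_mat[of _ n n _ k _ n] assoc_mult_mat[of _ n n _ n _ n])
  finally have "card {i. i < n \<and> T $$ (i, i) \<noteq> 0} \<le> k"
    by (rule card_nonzero_diag_le[OF T ut mult_carrier_mat[OF w(7) B]
          mult_carrier_mat[OF mat_adjoint_carrier[OF B] w(6)]])
  moreover have "card {i \<in> {..<n}. Re (T $$ (i, i)) \<noteq> 0} \<le> card {i. i < n \<and> T $$ (i, i) \<noteq> 0}"
    by (intro card_mono) auto
  ultimately have "size (filter_mset (\<lambda>x. x \<noteq> 0) (mset (real_eigenvalues H))) \<le> k"
    by (simp add: ev filter_mset_image_mset filter_mset_mset_set)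
  then have few: "length (filter (\<lambda>x. x \<noteq> 0) (rev (real_eigenvalues H))) \<le> k"
    by (metis mset_filter mset_rev size_mset)
  have "set (real_eigenvalues H) = (\<lambda>i. Re (T $$ (i, i))) ` {..<n}"
    using arg_cong[OF ev, of set_mset] by simp
  then have "0 \<le> x" if "x \<in> set (rev (real_eigenvalues H))" for x
    using that nonneg by auto
  then have "sum_list (take k (rev (real_eigenvalues H))) = sum_list (rev (real_eigenvalues H))"
    using few by (intro sum_list_take_sorted_desc) (auto simp: real_eigenvalues_def)
  then have "sum_list d = sum_list (real_eigenvalues H)"
    using d(2) by (metis mset_rev sum_mset_sum_list)
  also have "\<dots> = (\<Sum>i<n. Re (T $$ (i, i)))"
    using arg_cong[OF ev, of sum_mset] by (simp add: sum_mset_sum_list sum_unfold_sum_mset)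
  also have "\<dots> = (\<Sum>i<n. Re (H $$ (i, i)))"
    using arg_cong[OF similar_mat_wit_trace[OF H sim], of Re] by simp
  finally have trace: "sum_list d = (\<Sum>i<n. Re (H $$ (i, i)))" .
  have HC: "H = C * mat_adjoint C" by (simp add: H_def BC)
  have "H $$ (i, i) = of_real (\<Sum>q<p. (cmod (C $$ (i, q)))\<^sup>2)" if "i < n" for i
    using that C by (simp add: HC scalar_prod_def atLeast0LessThan complex_norm_square del: of_real_power)
  then have trace_C: "sum_list d = (\<Sum>q<p. \<Sum>i<n. (cmod (C $$ (i, q)))\<^sup>2)"
    unfolding trace by (subst sum.swap) simp
  define G where "G = mat_adjoint V * C"
  have G: "G \<in> carrier_mat k p"
    unfolding G_def by (rule mult_carrier_mat[OF mat_adjoint_carrier[OF V] C])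
  have Gi: "G $$ (j, q) = (\<Sum>i<n. cnj (V $$ (i, j)) * C $$ (i, q))" if "j < k" "q < p" for j q
    using that V C by (simp add: G_def scalar_prod_def atLeast0LessThan)
  have orth': "(\<Sum>i<n. V $$ (i, j) * cnj (V $$ (i, j'))) = (if j = j' then 1 else 0)" if "j < k" "j' < k" for j j'
    using orth[OF that] that V by (simp add: scalar_prod_def atLeast0LessThan)
  \<comment> \<open>The eigenvalue is the Rayleigh quotient of its unit eigenvector. Evaluated with
    the factor \<open>C\<close> instead of \<open>B\<close>, it is the squared norm of row
    \<open>j\<close> of \<open>G\<close>.\<close>
  have dj: "d ! j = (\<Sum>q<p. (cmod (G $$ (j, q)))\<^sup>2)" if j: "j < k" for j
  proof -
    have Vj: "col V j \<in> carrier_vec n" using V by auto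
    have "of_real (d ! j) = (H *\<^sub>v col V j) \<bullet>c col V j"
      using orth[OF j j] V by (simp add: eig[OF j])
    also have "H *\<^sub>v col V j = C *\<^sub>v (mat_adjoint C *\<^sub>v col V j)"
      unfolding HC by (rule assoc_mult_mat_vec[OF C mat_adjoint_carrier[OF C] Vj])
    also have "\<dots> \<bullet>c col V j = (mat_adjoint C *\<^sub>v col V j) \<bullet>c (mat_adjoint C *\<^sub>v col V j)"
      by (rule cscalar_prod_mat_adjoint[OF C mult_mat_vec_carrier[OF mat_adjoint_carrier[OF C] Vj] Vj])
    also have "\<dots> = of_real (\<Sum>q<p. (cmod ((mat_adjoint C *\<^sub>v col V j) $ q))\<^sup>2)"
      using C by (subst cscalar_prod_self) simp
    also have "(\<Sum>q<p. (cmod ((mat_adjoint C *\<^sub>v col V j) $ q))\<^sup>2) = (\<Sum>q<p. (cmod (G $$ (j, q)))\<^sup>2)"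
    proof (intro sum.cong refl)
      fix q assume q: "q \<in> {..<p}"
      have "(mat_adjoint C *\<^sub>v col V j) $ q = cnj (G $$ (j, q))"
        using q j C V by (simp add: Gi scalar_prod_def atLeast0LessThan mult.commute)
      then show "(cmod ((mat_adjoint C *\<^sub>v col V j) $ q))\<^sup>2 = (cmod (G $$ (j, q)))\<^sup>2" by simp
    qed
    finally show ?thesis by (simp only: of_real_eq_iff)
  qed
  have "sum_list d = (\<Sum>j<k. d ! j)"
    using d(1) by (simp add: sum_list_sum_nth atLeast0LessThan)
  also have "\<dots> = (\<Sum>q<p. \<Sum>j<k. (cmod (G $$ (j, q)))\<^sup>2)"
    by (subst sum.swap) (simp add: dj)
  finally have trace_G: "sum_list d = (\<Sum>q<p. \<Sum>j<k. (cmod (G $$ (j, q)))\<^sup>2)" .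
  \<comment> \<open>Bessel's identity for each column of \<open>C\<close>. After summation the
    right-hand side is the difference of the two expressions for \<open>sum_list d\<close>, so every
    residual vanishes.\<close>
  have "(\<Sum>q<p. \<Sum>i<n. (cmod (C $$ (i, q) - (\<Sum>j<k. V $$ (i, j) * G $$ (j, q))))\<^sup>2) =
      (\<Sum>q<p. (\<Sum>i<n. (cmod (C $$ (i, q)))\<^sup>2) - (\<Sum>j<k. (cmod (G $$ (j, q)))\<^sup>2))"
  proof (intro sum.cong refl)
    fix q assume q: "q \<in> {..<p}"
    show "(\<Sum>i<n. (cmod (C $$ (i, q) - (\<Sum>j<k. V $$ (i, j) * G $$ (j, q))))\<^sup>2) =
      (\<Sum>i<n. (cmod (C $$ (i, q)))\<^sup>2) - (\<Sum>j<k. (cmod (G $$ (j, q)))\<^sup>2)"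
      using bessel_residual[where n = n and V = "\<lambda>i j. V $$ (i, j)" and w = "\<lambda>i. C $$ (i, q)", OF orth'] q
      by (simp add: Gi)
  qed
  also have "\<dots> = 0" using trace_C trace_G by (simp add: sum_subtractf)
  finally have z: "\<forall>q\<in>{..<p}. (\<Sum>i<n. (cmod (C $$ (i, q) - (\<Sum>j<k. V $$ (i, j) * G $$ (j, q))))\<^sup>2) = 0"
    by (subst (asm) sum_nonneg_eq_0_iff) (auto intro: sum_nonneg)
  show "V * (mat_adjoint V * C) = C"
    unfolding G_def [symmetric]
  proof (rule eq_matI)
    fix i q assume "i < dim_row C" "q < dim_col C"
    then have iq: "i < n" "q < p" using C by auto
    then have "(\<Sum>i<n. (cmod (C $$ (i, q) - (\<Sum>j<k. V $$ (i, j) * G $$ (j, q))))\<^sup>2) = 0" using z by simp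
    then have "\<forall>i\<in>{..<n}. (cmod (C $$ (i, q) - (\<Sum>j<k. V $$ (i, j) * G $$ (j, q))))\<^sup>2 = 0"
      by (subst (asm) sum_nonneg_eq_0_iff) auto
    then have "C $$ (i, q) = (\<Sum>j<k. V $$ (i, j) * G $$ (j, q))" using iq by simp
    then show "(V * G) $$ (i, q) = C $$ (i, q)"
      using iq V G by (simp add: scalar_prod_def atLeast0LessThan)
  qed (use V G C in auto)
qed

section \<open>Moments of circular Gaussian variables\<close>

context prob_space
begin

lemma centered_normal_moments:
  assumes d: "distributed M lborel X (\<lambda>t. ennreal (normal_density 0 (sqrt (v / 2)) t))" and v: "0 < v"
  shows "integrable M (\<lambda>\<omega>. X \<omega> ^ n)"
    and "odd n \<Longrightarrow> expectation (\<lambda>\<omega>. X \<omega> ^ n) = 0"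
    and "expectation (\<lambda>\<omega>. X \<omega> ^ 2) = v / 2"
    and "expectation (\<lambda>\<omega>. X \<omega> ^ 4) = 3 * v\<^sup>2 / 4"
proof -
  let ?d = "normal_density 0 (sqrt (v / 2))"
  have s: "0 < sqrt (v / 2)" using v by simp
  have E: "expectation (\<lambda>\<omega>. X \<omega> ^ n) = (\<integral>t. ?d t * t ^ n \<partial>lborel)" for n
    by (rule distributed_integral[OF d, symmetric]) simp_all
  have "integrable lborel (\<lambda>t. ?d t * t ^ n)"
    using integrable_normal_moment[OF s, of 0 n] by simp
  then show "integrable M (\<lambda>\<omega>. X \<omega> ^ n)"
    by (subst distributed_integrable[OF d, symmetric]) simp_all
  show "expectation (\<lambda>\<omega>. X \<omega> ^ n) = 0" if "odd n"
    using that integral_normal_moment_odd[OF s, of 0] by (auto simp: E elim!: oddE)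
  show "expectation (\<lambda>\<omega>. X \<omega> ^ 2) = v / 2"
    using integral_normal_moment_even[OF s, of 0 1] v by (simp add: E)
  show "expectation (\<lambda>\<omega>. X \<omega> ^ 4) = 3 * v\<^sup>2 / 4"
    using integral_normal_moment_even[OF s, of 0 2] v
    by (simp add: E fact_numeral power2_eq_square field_simps)
qed

text \<open>Binomial expansion in the independent real and imaginary parts leaves real moments of
  order at most 4. Exponents up to 2 suffice for the trispectrum, where two factors are plain and
  two are conjugated.\<close>

lemma circ_complex_normal_moments:
  assumes c: "circ_complex_normal M v Z" and v: "0 < v" and p: "p \<le> 2" and q: "q \<le> 2"
  shows "has_bochner_integral M (\<lambda>\<omega>. Z \<omega> ^ p * cnj (Z \<omega>) ^ q) (if p = q then fact p * of_real v ^ p else 0)"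
proof -
  define R where "R = (\<lambda>\<omega>. Re (Z \<omega>))"
  define J where "J = (\<lambda>\<omega>. Im (Z \<omega>))"
  \<comment> \<open>Moments of a centred real normal variable of variance \<open>v / 2\<close>, as
    each part carries half of the variance. The values are meaningful up to \<open>n = 4\<close>
    only; beyond that, \<open>0\<close> is a mere default.\<close>
  define m where "m n = (if n = 0 then 1 else if n = 2 then v / 2 else if n = 4 then 3 * v\<^sup>2 / 4 else 0)" for n :: nat
  have ind: "indep_var borel R borel J"
    and dR: "distributed M lborel R (\<lambda>t. ennreal (normal_density 0 (sqrt (v / 2)) t))"
    and dJ: "distributed M lborel J (\<lambda>t. ennreal (normal_density 0 (sqrt (v / 2)) t))"
    using c by (simp_all add: circ_complex_normal_def R_def J_def)
  have m: "expectation (\<lambda>\<omega>. X \<omega> ^ n) = m n"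
    if "distributed M lborel X (\<lambda>t. ennreal (normal_density 0 (sqrt (v / 2)) t))" "n \<le> 4" for X n
  proof -
    have "n = 0 \<or> n = 2 \<or> n = 4 \<or> odd n" using that(2) by presburger
    then show ?thesis
      using centered_normal_moments(2-4)[OF that(1) v] by (auto simp: m_def prob_space)
  qed
  have hb: "has_bochner_integral M (\<lambda>\<omega>. complex_of_real (R \<omega> ^ i * J \<omega> ^ j)) (of_real (m i * m j))"
    if "i \<le> 4" "j \<le> 4" for i j
  proof -
    have ind': "indep_var borel (\<lambda>\<omega>. R \<omega> ^ i) borel (\<lambda>\<omega>. J \<omega> ^ j)"
      using indep_var_compose[OF ind, of "\<lambda>x. x ^ i" borel "\<lambda>x. x ^ j" borel] by (simp add: o_def)
    note int = centered_normal_moments(1)[OF dR v, of i] centered_normal_moments(1)[OF dJ v, of j]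
    have "has_bochner_integral M (\<lambda>\<omega>. R \<omega> ^ i * J \<omega> ^ j) (m i * m j)"
      using indep_var_integrable[OF ind' int] indep_var_lebesgue_integral[OF ind' int]
      by (simp add: has_bochner_integral_iff m[OF dR] m[OF dJ] that)
    then show ?thesis by (rule has_bochner_integral_of_real)
  qed
  define co where "co j k = of_nat (p choose j) * of_nat (q choose k) * \<i> ^ (p - j) * (- \<i>) ^ (q - k)" for j k
  have Zp: "Z \<omega> ^ p * cnj (Z \<omega>) ^ q =
      (\<Sum>j\<le>p. \<Sum>k\<le>q. co j k * complex_of_real (R \<omega> ^ (j + k) * J \<omega> ^ ((p - j) + (q - k))))" for \<omega>
  proof -
    have Z: "Z \<omega> = of_real (R \<omega>) + \<i> * of_real (J \<omega>)" "cnj (Z \<omega>) = of_real (R \<omega>) + (- \<i>) * of_real (J \<omega>)"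
      by (simp_all add: R_def J_def complex_eq_iff)
    show ?thesis
      unfolding Z(2) unfolding Z(1) binomial_ring sum_product
      by (intro sum.cong refl) (simp only: co_def power_mult_distrib power_add of_real_mult of_real_power mult_ac)
  qed
  have "has_bochner_integral M (\<lambda>\<omega>. Z \<omega> ^ p * cnj (Z \<omega>) ^ q)
      (\<Sum>j\<le>p. \<Sum>k\<le>q. co j k * of_real (m (j + k) * m ((p - j) + (q - k))))"
    unfolding Zp using p q
    by (intro has_bochner_integral_sum has_bochner_integral_mult_right hb) auto
  also have "(\<Sum>j\<le>p. \<Sum>k\<le>q. co j k * of_real (m (j + k) * m ((p - j) + (q - k)))) =
      (if p = q then fact p * of_real v ^ p else 0)"
  proof -
    have "p = 0 \<or> p = 1 \<or> p = 2" "q = 0 \<or> q = 1 \<or> q = 2" using p q by auto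
    then show ?thesis
      by (elim disjE) (simp_all add: co_def m_def numeral_2_eq_2 field_simps)
  qed
  finally show ?thesis .
qed

lemma indep_circ_complex_normal_moments:
  fixes a :: "nat \<Rightarrow> 'a \<Rightarrow> complex"
  assumes c: "\<And>t. t < r \<Longrightarrow> circ_complex_normal M (lam t) (a t)"
    and ind: "indep_vars (\<lambda>_. borel) a {..<r}" and lam: "\<And>t. t < r \<Longrightarrow> 0 < lam t"
    and p: "\<And>t. t < r \<Longrightarrow> p t \<le> 2" and q: "\<And>t. t < r \<Longrightarrow> q t \<le> 2"
  shows "has_bochner_integral M (\<lambda>\<omega>. \<Prod>t<r. a t \<omega> ^ p t * cnj (a t \<omega>) ^ q t)
    (\<Prod>t<r. if p t = q t then fact (p t) * of_real (lam t) ^ p t else 0)"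
proof -
  note hb = circ_complex_normal_moments[OF c lam p q]
  have ind': "indep_vars (\<lambda>_. borel) (\<lambda>t \<omega>. a t \<omega> ^ p t * cnj (a t \<omega>) ^ q t) {..<r}"
    by (rule indep_vars_compose2[OF ind]) (auto intro!: borel_measurable_continuous_onI continuous_intros)
  have int: "integrable M (\<lambda>\<omega>. a t \<omega> ^ p t * cnj (a t \<omega>) ^ q t)" if "t \<in> {..<r}" for t
    using hb[of t] that by (simp add: has_bochner_integral_iff)
  have ex: "expectation (\<lambda>\<omega>. a t \<omega> ^ p t * cnj (a t \<omega>) ^ q t) = 
     (if p t = q t then fact (p t) * of_real (lam t) ^ p t else 0)" if "t \<in> {..<r}" for t
    using hb[of t] that by (simp add: has_bochner_integral_iff)
  have "expectation (\<lambda>\<omega>. \<Prod>t<r. a t \<omega> ^ p t * cnj (a t \<omega>) ^ q t) =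
      (\<Prod>t<r. expectation (\<lambda>\<omega>. a t \<omega> ^ p t * cnj (a t \<omega>) ^ q t))"
    by (rule indep_vars_lebesgue_integral[OF _ ind' int]) simp_all
  also have "\<dots> = (\<Prod>t<r. if p t = q t then fact (p t) * of_real (lam t) ^ p t else 0)"
    by (intro prod.cong refl ex)
  finally show ?thesis
    using indep_vars_integrable[OF _ ind' int] by (simp add: has_bochner_integral_iff)
qed

text \<open>The product is a monomial whose exponents are indicators of \<open>i\<close> and of
  \<open>j\<close>. Its expectation survives only if plain and conjugated exponents agree for every
  variable.\<close>

lemma circ_second_moment:
  fixes a :: "nat \<Rightarrow> 'a \<Rightarrow> complex"
  assumes c: "\<And>t. t < r \<Longrightarrow> circ_complex_normal M (lam t) (a t)"
    and ind: "indep_vars (\<lambda>_. borel) a {..<r}" and lam: "\<And>t. t < r \<Longrightarrow> 0 < lam t"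
    and ij: "i < r" "j < r"
  shows "has_bochner_integral M (\<lambda>\<omega>. a i \<omega> * cnj (a j \<omega>)) (of_bool (i = j) * of_real (lam i))"
proof -
  have delta: "(\<Prod>t<r. f t ^ of_bool (t = i)) = f i" if "i < r" for f :: "nat \<Rightarrow> complex" and i
    using that by (simp add: of_bool_def if_distrib prod.delta cong: if_cong)
  let ?p = "\<lambda>t. of_bool (t = i) :: nat" and ?q = "\<lambda>t. of_bool (t = j) :: nat"
  have 1: "(\<lambda>\<omega>. \<Prod>t<r. a t \<omega> ^ ?p t * cnj (a t \<omega>) ^ ?q t) = (\<lambda>\<omega>. a i \<omega> * cnj (a j \<omega>))"
    using ij by (simp add: prod.distrib delta)
  have 2: "(\<Prod>t<r. if ?p t = ?q t then fact (?p t) * complex_of_real (lam t) ^ ?p t else 0) =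
      of_bool (i = j) * of_real (lam i)"
  proof (cases "i = j")
    case True
    have "(\<Prod>t<r. if ?p t = ?q t then fact (?p t) * complex_of_real (lam t) ^ ?p t else 0) =
        (\<Prod>t<r. of_real (lam t) ^ ?p t)"
      using True by (intro prod.cong) auto
    then show ?thesis using ij True by (simp add: delta)
  next
    case False
    then have "(\<Prod>t<r. if ?p t = ?q t then fact (?p t) * complex_of_real (lam t) ^ ?p t else 0) = 0"
      using ij by (intro prod_zero) (auto intro!: bexI[of _ i])
    then show ?thesis using False by simp
  qed
  show ?thesis
    using indep_circ_complex_normal_moments[OF c ind lam, of ?p ?q] unfolding 1 2 by simp
qed

text \<open>Again a monomial with indicator exponents. Equal exponents mean that the plain indices
  pair off with the conjugated ones. For \<open>i = k\<close> the factorial contributes a factor 2,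
  which is matched by both pairings holding at once.\<close>

lemma circ_fourth_moment:
  fixes a :: "nat \<Rightarrow> 'a \<Rightarrow> complex"
  assumes c: "\<And>t. t < r \<Longrightarrow> circ_complex_normal M (lam t) (a t)"
    and ind: "indep_vars (\<lambda>_. borel) a {..<r}" and lam: "\<And>t. t < r \<Longrightarrow> 0 < lam t"
    and ij: "i < r" "j < r" "k < r" "l < r"
  shows "has_bochner_integral M (\<lambda>\<omega>. a i \<omega> * cnj (a j \<omega>) * a k \<omega> * cnj (a l \<omega>))
    (of_real (lam i) * of_real (lam k) * (of_bool (i = j) * of_bool (k = l) + of_bool (i = l) * of_bool (k = j)))"
proof -
  have delta: "(\<Prod>t<r. f t ^ of_bool (t = i)) = f i" if "i < r" for f :: "nat \<Rightarrow> complex" and i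
    using that by (simp add: of_bool_def if_distrib prod.delta cong: if_cong)
  let ?p = "\<lambda>t. of_bool (t = i) + of_bool (t = k) :: nat" and ?q = "\<lambda>t. of_bool (t = j) + of_bool (t = l) :: nat"
  have 1: "(\<lambda>\<omega>. \<Prod>t<r. a t \<omega> ^ ?p t * cnj (a t \<omega>) ^ ?q t) = (\<lambda>\<omega>. a i \<omega> * cnj (a j \<omega>) * a k \<omega> * cnj (a l \<omega>))"
    using ij by (simp add: prod.distrib power_add delta mult_ac)
  have 2: "(\<Prod>t<r. if ?p t = ?q t then fact (?p t) * complex_of_real (lam t) ^ ?p t else 0) =
      of_real (lam i) * of_real (lam k) * (of_bool (i = j) * of_bool (k = l) + of_bool (i = l) * of_bool (k = j))"
  proof (cases "i = j \<and> k = l \<or> i = l \<and> k = j")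
    case True
    have "(\<Prod>t<r. if ?p t = ?q t then fact (?p t) * complex_of_real (lam t) ^ ?p t else 0) =
        (\<Prod>t<r. fact (?p t)) * (\<Prod>t<r. of_real (lam t) ^ of_bool (t = i) * of_real (lam t) ^ of_bool (t = k))"
      unfolding prod.distrib [symmetric] using True by (intro prod.cong) (auto simp: power_add)
    also have "\<dots> = (\<Prod>t<r. fact (?p t)) * (of_real (lam i) * of_real (lam k))"
      using ij by (simp add: prod.distrib delta)
    also have "(\<Prod>t<r. fact (?p t)) = (if i = k then 2 else 1 :: complex)"
    proof (cases "i = k")
      case True
      have "(\<Prod>t<r. fact (?p t)) = (\<Prod>t<r. if t = i then 2 else 1 :: complex)"
        using True by (intro prod.cong) (auto simp: fact_numeral)
      then show ?thesis using True ij by simp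
    next
      case False
      then have "(\<Prod>t<r. fact (?p t)) = (\<Prod>t<r. 1 :: complex)"
        by (intro prod.cong) auto
      then show ?thesis using False by simp
    qed
    finally show ?thesis using True by auto
  next
    case False
    \<comment> \<open>It is enough to compare exponents at \<open>i\<close> and \<open>k\<close>:
      agreement at these two places would already force one of the pairings.\<close>
    have "\<exists>t\<in>{i, k}. ?p t \<noteq> ?q t"
    proof (rule ccontr)
      assume "\<not> (\<exists>t\<in>{i, k}. ?p t \<noteq> ?q t)"
      then have e: "1 + of_bool (i = k) = (of_bool (i = j) + of_bool (i = l) :: nat)"
        "1 + of_bool (k = i) = (of_bool (k = j) + of_bool (k = l) :: nat)" by auto
      show False
      proof (cases "i = j")
        case True
        then show False using e False by (cases "i = k"; cases "i = l"; simp)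
      next
        case ij: False
        then have "i = l" "i \<noteq> k" using e(1) by (cases "i = l"; cases "i = k"; simp)+
        then show False using e(2) False by (cases "k = j"; simp)
      qed
    qed
    then obtain t where t: "t \<in> {i, k}" "?p t \<noteq> ?q t" by blast
    then have tr: "t \<in> {..<r}" using ij by auto
    have 0: "(\<Prod>t<r. if ?p t = ?q t then fact (?p t) * complex_of_real (lam t) ^ ?p t else 0) = 0"
      by (rule prod_zero[OF finite_lessThan], rule bexI[where x = t], rule if_not_P[OF t(2)], rule tr)
    have "of_bool (i = j) * of_bool (k = l) = (0 :: complex)" "of_bool (i = l) * of_bool (k = j) = (0 :: complex)"
      using False by (cases "i = j"; simp) (cases "i = l"; use False in simp)
    then show ?thesis unfolding 0 by (simp only: mult_zero_right add_0_left)
  qed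
  have "has_bochner_integral M (\<lambda>\<omega>. \<Prod>t<r. a t \<omega> ^ ?p t * cnj (a t \<omega>) ^ ?q t)
      (\<Prod>t<r. if ?p t = ?q t then fact (?p t) * complex_of_real (lam t) ^ ?p t else 0)"
    by (rule indep_circ_complex_normal_moments[OF c ind lam]) (simp_all add: of_bool_def)
  then show ?thesis unfolding 1 2 .
qed

lemma circ_covariance:
  fixes a :: "nat \<Rightarrow> 'a \<Rightarrow> complex"
  assumes c: "\<And>t. t < r \<Longrightarrow> circ_complex_normal M (lam t) (a t)"
    and ind: "indep_vars (\<lambda>_. borel) a {..<r}" and lam: "\<And>t. t < r \<Longrightarrow> 0 < lam t"
  shows "expectation (\<lambda>\<omega>. (\<Sum>i<r. a i \<omega> * f i) * cnj (\<Sum>i<r. a i \<omega> * g i)) =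
    (\<Sum>i<r. of_real (lam i) * f i * cnj (g i))"
proof -
  have "has_bochner_integral M (\<lambda>\<omega>. \<Sum>i<r. \<Sum>j<r. f i * cnj (g j) * (a i \<omega> * cnj (a j \<omega>)))
      (\<Sum>i<r. \<Sum>j<r. f i * cnj (g j) * (of_bool (i = j) * of_real (lam i)))"
    by (intro has_bochner_integral_sum has_bochner_integral_mult_right circ_second_moment[OF c ind lam]) auto
  moreover have "(\<lambda>\<omega>. \<Sum>i<r. \<Sum>j<r. f i * cnj (g j) * (a i \<omega> * cnj (a j \<omega>))) =
      (\<lambda>\<omega>. (\<Sum>i<r. a i \<omega> * f i) * cnj (\<Sum>i<r. a i \<omega> * g i))"
    by (simp add: sum_product mult_ac)
  moreover have "(\<Sum>j<r. f i * cnj (g j) * (of_bool (i = j) * of_real (lam i))) = of_real (lam i) * f i * cnj (g i)"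
    if "i < r" for i
  proof -
    have "(\<Sum>j<r. f i * cnj (g j) * (of_bool (i = j) * of_real (lam i))) =
        (\<Sum>j<r. if j = i then of_real (lam i) * f i * cnj (g i) else 0)"
      by (intro sum.cong) auto
    then show ?thesis using that by simp
  qed
  ultimately show ?thesis by (simp add: has_bochner_integral_iff)
qed

text \<open>Multilinear expansion reduces the claim to fourth moments of the coefficients. The third
  pairing of the real formula, which joins the two plain factors, is absent because circularity
  makes unconjugated second moments vanish.\<close>

lemma isserlis_circ:
  fixes a :: "nat \<Rightarrow> 'a \<Rightarrow> complex" and f1 f2 f3 f4 :: "nat \<Rightarrow> complex"
  assumes c: "\<And>t. t < r \<Longrightarrow> circ_complex_normal M (lam t) (a t)"
    and ind: "indep_vars (\<lambda>_. borel) a {..<r}" and lam: "\<And>t. t < r \<Longrightarrow> 0 < lam t"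
  defines "K \<equiv> \<lambda>f g. \<Sum>i<r. of_real (lam i) * f i * cnj (g i)"
  shows "expectation (\<lambda>\<omega>. (\<Sum>i<r. a i \<omega> * f1 i) * cnj (\<Sum>i<r. a i \<omega> * f2 i) *
      (\<Sum>i<r. a i \<omega> * f3 i) * cnj (\<Sum>i<r. a i \<omega> * f4 i)) = K f1 f2 * K f3 f4 + K f1 f4 * K f3 f2"
proof -
  let ?F = "\<lambda>i j k l. f1 i * cnj (f2 j) * f3 k * cnj (f4 l)"
  let ?d = "\<lambda>i j k l :: nat. of_real (lam i) * of_real (lam k) *
      (of_bool (i = j) * of_bool (k = l) + of_bool (i = l) * of_bool (k = j)) :: complex"
  have 1: "has_bochner_integral M (\<lambda>\<omega>. \<Sum>i<r. \<Sum>j<r. \<Sum>k<r. \<Sum>l<r. ?F i j k l * (a i \<omega> * cnj (a j \<omega>) * a k \<omega> * cnj (a l \<omega>)))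
      (\<Sum>i<r. \<Sum>j<r. \<Sum>k<r. \<Sum>l<r. ?F i j k l * ?d i j k l)"
    by (intro has_bochner_integral_sum has_bochner_integral_mult_right circ_fourth_moment[OF c ind lam]) auto
  have 2: "(\<lambda>\<omega>. \<Sum>i<r. \<Sum>j<r. \<Sum>k<r. \<Sum>l<r. ?F i j k l * (a i \<omega> * cnj (a j \<omega>) * a k \<omega> * cnj (a l \<omega>))) =
    (\<lambda>\<omega>. (\<Sum>i<r. a i \<omega> * f1 i) * cnj (\<Sum>i<r. a i \<omega> * f2 i) *
      (\<Sum>i<r. a i \<omega> * f3 i) * cnj (\<Sum>i<r. a i \<omega> * f4 i))"
  proof -
    have "?F i j k l * (a i \<omega> * cnj (a j \<omega>) * a k \<omega> * cnj (a l \<omega>)) =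
        (a i \<omega> * f1 i) * cnj (a j \<omega> * f2 j) * (a k \<omega> * f3 k) * cnj (a l \<omega> * f4 l)" for i j k l \<omega>
      by (simp add: mult_ac)
    then show ?thesis by (simp only: cnj_sum flip: sum_distrib_left sum_distrib_right)
  qed
  have inner: "(\<Sum>j<r. \<Sum>l<r. ?F i j k l * ?d i j k l) =
      of_real (lam i) * of_real (lam k) * f1 i * f3 k * (cnj (f2 i) * cnj (f4 k) + cnj (f4 i) * cnj (f2 k))"
    if "i < r" "k < r" for i k
  proof -
    have "(\<Sum>j<r. \<Sum>l<r. ?F i j k l * ?d i j k l) =
        (\<Sum>j<r. \<Sum>l<r. if l = k then if j = i then ?F i i k k * of_real (lam i) * of_real (lam k) else 0 else 0) +
        (\<Sum>j<r. \<Sum>l<r. if l = i then if j = k then ?F i k k i * of_real (lam i) * of_real (lam k) else 0 else 0)"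
      unfolding sum.distrib [symmetric] by (intro sum.cong refl) (auto simp: algebra_simps)
    then show ?thesis using that by (simp add: algebra_simps)
  qed
  have "(\<Sum>i<r. \<Sum>j<r. \<Sum>k<r. \<Sum>l<r. ?F i j k l * ?d i j k l) = (\<Sum>i<r. \<Sum>k<r. \<Sum>j<r. \<Sum>l<r. ?F i j k l * ?d i j k l)"
    by (intro sum.cong refl sum.swap)
  also have "\<dots> = (\<Sum>i<r. \<Sum>k<r. of_real (lam i) * of_real (lam k) * f1 i * f3 k *
      (cnj (f2 i) * cnj (f4 k) + cnj (f4 i) * cnj (f2 k)))"
    by (intro sum.cong refl inner) auto
  also have "\<dots> = K f1 f2 * K f3 f4 + K f1 f4 * K f3 f2"
    by (simp add: K_def sum_product sum.distrib algebra_simps)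
  finally show ?thesis using 1 unfolding 2 by (simp add: has_bochner_integral_iff)
qed

end

section \<open>The discrete Fourier transform and the spectra\<close>

text \<open>The phases of the Fourier vectors as a character of the integers, so that frequencies
  and shifts can be added and subtracted without reduction modulo \<open>L\<close>.\<close>

definition root_phase :: "nat \<Rightarrow> int \<Rightarrow> complex" where
  "root_phase L n = cis (- (2 * pi * real_of_int n / real L))"

lemma root_phase_0 [simp]: "root_phase L 0 = 1"
  by (simp add: root_phase_def)

lemma root_phase_add: "root_phase L (m + n) = root_phase L m * root_phase L n"
  by (simp add: root_phase_def cis_mult add_divide_distrib ring_distribs)

lemma root_phase_minus: "root_phase L (- n) = cnj (root_phase L n)"
  by (simp add: root_phase_def cis_cnj)

lemma root_phase_diff: "root_phase L (m - n) = root_phase L m * cnj (root_phase L n)"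
  using root_phase_add[of L m "- n"] by (simp add: root_phase_minus)

lemma root_phase_period: "0 < L \<Longrightarrow> root_phase L (int L * n) = 1"
  using cis_multiple_2pi[of "- real_of_int n"] by (simp add: root_phase_def mult_ac)

lemma root_phase_cong:
  assumes "0 < L" and "m mod int L = n mod int L"
  shows "root_phase L m = root_phase L n"
proof -
  obtain d where "m = n + int L * d"
    using assms(2) by (metis mod_eqE add.commute add_diff_cancel_right' diff_add_cancel)
  then show ?thesis using assms(1) by (simp add: root_phase_add root_phase_period)
qed

lemma root_phase_mod_mult:
  "0 < L \<Longrightarrow> root_phase L ((k mod int L) * n) = root_phase L (k * n)"
  by (rule root_phase_cong) (simp_all add: mod_mult_left_eq)

lemma root_phase_mult_cnj [simp]: "root_phase L n * cnj (root_phase L n) = 1"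
  using root_phase_diff[of L n n] by simp

lemma fourier_vec_index: "k < L \<Longrightarrow> fourier_vec L l $ k = root_phase L (int k * int l)"
  by (simp add: fourier_vec_def root_phase_def cis_conv_exp mult_ac)

lemma dft_dim [simp]: "dim_vec (dft x) = dim_vec x"
  by (simp add: dft_def dft_mat_def)

lemma dft_index:
  assumes "x \<in> carrier_vec L" and "k < L"
  shows "dft x $ k = (\<Sum>l<L. complex_of_real (1 / sqrt (real L)) * root_phase L (int k * int l) * x $ l)"
  using assms by (simp add: dft_def dft_mat_def scalar_prod_def atLeast0LessThan fourier_vec_index mult_ac)

text \<open>The shift theorem: reindexing the sum by \<open>l - s\<close> modulo \<open>L\<close>
  splits off a phase that is independent of the summation index.\<close>

lemma dft_cyclic_shift:
  assumes x: "x \<in> carrier_vec L" and k: "k < L"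
  shows "dft (cyclic_shift s x) $ k = root_phase L (int k * int s) * dft x $ k"
proof -
  have L: "0 < L" using k by simp
  let ?c = "complex_of_real (1 / sqrt (real L))"
  let ?h = "\<lambda>l. nat ((int l - int s) mod int L)"
  have sx: "cyclic_shift s x \<in> carrier_vec L" using x by (intro carrier_vecI) (simp add: cyclic_shift_def)
  have h: "?h l < L" for l using L by (simp add: nat_less_iff)
  have "dft (cyclic_shift s x) $ k = (\<Sum>l<L. ?c * root_phase L (int k * int l) * x $ ?h l)"
    using x by (subst dft_index[OF sx k]) (simp add: cyclic_shift_def vec_at_def)
  also have "\<dots> = (\<Sum>l<L. root_phase L (int k * int s) * (?c * root_phase L (int k * int (?h l)) * x $ ?h l))"
  proof (intro sum.cong refl)
    fix l
    have "root_phase L (int k * int l) = root_phase L (int k * int s) * root_phase L (int k * (int l - int s))"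
      unfolding root_phase_add [symmetric] by (simp add: algebra_simps)
    also have "root_phase L (int k * (int l - int s)) = root_phase L (int k * int (?h l))"
      using L root_phase_mod_mult[OF L, of "int l - int s" "int k"] by (simp add: mult.commute)
    finally show "?c * root_phase L (int k * int l) * x $ ?h l =
        root_phase L (int k * int s) * (?c * root_phase L (int k * int (?h l)) * x $ ?h l)"
      by (simp only: mult_ac)
  qed
  also have "\<dots> = (\<Sum>l<L. root_phase L (int k * int s) * (?c * root_phase L (int k * int l) * x $ l))"
  proof (rule sum.reindex_bij_witness[where j = ?h and i = "\<lambda>l. nat ((int l + int s) mod int L)"])
    show "nat ((int (?h l) + int s) mod int L) = l" if "l \<in> {..<L}" for l
      using that L by (simp add: mod_simps)
    show "?h (nat ((int l + int s) mod int L)) = l" if "l \<in> {..<L}" for l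
      using that L by (simp add: mod_simps)
  qed (use L h in \<open>auto simp: nat_less_iff\<close>)
  also have "\<dots> = root_phase L (int k * int s) * dft x $ k"
    by (simp only: dft_index[OF x k] sum_distrib_left)
  finally show ?thesis .
qed

lemma vec_at_dft_cyclic_shift:
  assumes x: "x \<in> carrier_vec L" and L: "0 < L"
  shows "vec_at (dft (cyclic_shift s x)) k = root_phase L (k * int s) * vec_at (dft x) k"
proof -
  have "nat (k mod int L) < L" using L by (simp add: nat_less_iff)
  from dft_cyclic_shift[OF x this, of s] show ?thesis
    using x L by (simp add: vec_at_def cyclic_shift_def root_phase_mod_mult)
qed

lemma dft_lincomb:
  assumes v: "\<And>i. i < r \<Longrightarrow> v i \<in> carrier_vec L" and k: "k < L"
  shows "dft (Matrix.vec L (\<lambda>l. \<Sum>i<r. c i * v i $ l)) $ k = (\<Sum>i<r. c i * dft (v i) $ k)"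
proof -
  have "dft (Matrix.vec L (\<lambda>l. \<Sum>i<r. c i * v i $ l)) $ k =
      (\<Sum>l<L. \<Sum>i<r. c i * (complex_of_real (1 / sqrt (real L)) * root_phase L (int k * int l) * v i $ l))"
    by (subst dft_index[of _ L]) (simp_all add: k sum_distrib_left sum_divide_distrib mult_ac)
  also have "\<dots> = (\<Sum>i<r. c i * dft (v i) $ k)"
    by (subst sum.swap) (simp add: dft_index[OF v k] sum_distrib_left)
  finally show ?thesis .
qed

text \<open>The phases cancel pointwise in \<open>\<omega>\<close>, before any expectation is taken,
  since the signed frequencies add up to zero. What remains are moments of linear forms in the
  coefficients \<open>a i\<close>, given by \<open>circ_covariance\<close> and
  \<open>isserlis_circ\<close>.\<close>

lemma (in prob_space) spectra_of_shifted_signal: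
  fixes a :: "nat \<Rightarrow> 'a \<Rightarrow> complex"
  assumes L: "0 < L" and v: "\<And>i. i < r \<Longrightarrow> v i \<in> carrier_vec L"
    and lam: "\<And>i. i < r \<Longrightarrow> 0 < lam i"
    and c: "\<And>i. i < r \<Longrightarrow> circ_complex_normal M (lam i) (a i)"
    and ind: "indep_vars (\<lambda>_. borel) a {..<r}"
    and x: "\<And>\<omega>. \<omega> \<in> space M \<Longrightarrow> x \<omega> = Matrix.vec L (\<lambda>l. \<Sum>i<r. a i \<omega> * v i $ l)"
    and y: "\<And>\<omega>. \<omega> \<in> space M \<Longrightarrow> y \<omega> = cyclic_shift (s \<omega>) (x \<omega>)"
  defines "S \<equiv> covariance_dft M L x"
  shows covariance_dft_eq:
      "mat_at S k m = (\<Sum>i<r. of_real (lam i) * vec_at (dft (v i)) k * cnj (vec_at (dft (v i)) m))"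
    and power_spectrum_eq: "power_spectrum M y k = P_map S k"
    and trispectrum_eq: "trispectrum M y k1 k2 k3 = T_map S k1 k2 k3"
proof -
  define g where "g k i = vec_at (dft (v i)) k" for k i
  have xc: "x \<omega> \<in> carrier_vec L" if "\<omega> \<in> space M" for \<omega> using x[OF that] by simp
  have nat_less: "nat (k mod int L) < L" for k using L by (simp add: nat_less_iff)
  have xg: "vec_at (dft (x \<omega>)) k = (\<Sum>i<r. a i \<omega> * g k i)" if "\<omega> \<in> space M" for \<omega> k
  proof -
    have "dim_vec (v i) = L" if "i < r" for i using v[OF that] by simp
    then show ?thesis
      using dft_lincomb[of r v L, OF v nat_less[of k], where c = "\<lambda>i. a i \<omega>"]
      by (simp add: x[OF that] vec_at_def g_def cong: sum.cong_simp)
  qed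
  have yg: "vec_at (dft (y \<omega>)) k = root_phase L (k * int (s \<omega>)) * (\<Sum>i<r. a i \<omega> * g k i)"
    if "\<omega> \<in> space M" for \<omega> k
    by (simp add: y[OF that] vec_at_dft_cyclic_shift[OF xc[OF that] L] xg[OF that])
  define K where "K k m = (\<Sum>i<r. of_real (lam i) * g k i * cnj (g m i))" for k m
  note cov = circ_covariance[OF c ind lam]
  have SK: "mat_at S k m = K k m" for k m
  proof -
    have "mat_at S k m = expectation (\<lambda>\<omega>. dft (x \<omega>) $ nat (k mod int L) * cnj (dft (x \<omega>) $ nat (m mod int L)))"
      using nat_less by (simp add: S_def covariance_dft_def mat_at_def)
    also have "\<dots> = expectation (\<lambda>\<omega>. (\<Sum>i<r. a i \<omega> * g k i) * cnj (\<Sum>i<r. a i \<omega> * g m i))"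
    proof (intro Bochner_Integration.integral_cong refl)
      fix \<omega> assume w: "\<omega> \<in> space M"
      show "dft (x \<omega>) $ nat (k mod int L) * cnj (dft (x \<omega>) $ nat (m mod int L)) =
        (\<Sum>i<r. a i \<omega> * g k i) * cnj (\<Sum>i<r. a i \<omega> * g m i)"
        using xg[OF w, of k] xg[OF w, of m] xc[OF w] by (simp add: vec_at_def)
    qed
    also have "\<dots> = K k m" unfolding K_def by (rule cov)
    finally show ?thesis .
  qed
  then show "mat_at S k m = (\<Sum>i<r. of_real (lam i) * vec_at (dft (v i)) k * cnj (vec_at (dft (v i)) m))"
    by (simp add: K_def g_def)
  have "power_spectrum M y k = expectation (\<lambda>\<omega>. (\<Sum>i<r. a i \<omega> * g k i) * cnj (\<Sum>i<r. a i \<omega> * g k i))"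
    unfolding power_spectrum_def
  proof (intro Bochner_Integration.integral_cong refl)
    fix \<omega> assume w: "\<omega> \<in> space M"
    let ?A = "\<Sum>i<r. a i \<omega> * g k i" and ?e = "root_phase L (k * int (s \<omega>))"
    have "vec_at (dft (y \<omega>)) k * cnj (vec_at (dft (y \<omega>)) k) = (?e * cnj ?e) * (?A * cnj ?A)"
      by (simp only: yg[OF w] complex_cnj_mult mult_ac)
    then show "vec_at (dft (y \<omega>)) k * cnj (vec_at (dft (y \<omega>)) k) = ?A * cnj ?A"
      by simp
  qed
  then show "power_spectrum M y k = P_map S k"
    by (simp only: P_map_def SK K_def cov)
  have "trispectrum M y k1 k2 k3 = expectation (\<lambda>\<omega>. (\<Sum>i<r. a i \<omega> * g k1 i) * cnj (\<Sum>i<r. a i \<omega> * g k2 i) *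
      (\<Sum>i<r. a i \<omega> * g k3 i) * cnj (\<Sum>i<r. a i \<omega> * g (k1 - k2 + k3) i))"
    unfolding trispectrum_def
  proof (intro Bochner_Integration.integral_cong refl)
    fix \<omega> assume w: "\<omega> \<in> space M"
    let ?A = "\<lambda>k. \<Sum>i<r. a i \<omega> * g k i" and ?e = "\<lambda>k. root_phase L (k * int (s \<omega>))"
    have "?e (k1 - k2 + k3) = ?e k1 * cnj (?e k2) * ?e k3"
      by (simp only: ring_distribs left_diff_distrib root_phase_add root_phase_diff)
    then have "?e k1 * cnj (?e k2) * ?e k3 * cnj (?e (k1 - k2 + k3)) = 1"
      by (metis root_phase_mult_cnj)
    moreover have "vec_at (dft (y \<omega>)) k1 * cnj (vec_at (dft (y \<omega>)) k2) *
          vec_at (dft (y \<omega>)) k3 * cnj (vec_at (dft (y \<omega>)) (k1 - k2 + k3)) =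
        (?e k1 * cnj (?e k2) * ?e k3 * cnj (?e (k1 - k2 + k3))) *
        (?A k1 * cnj (?A k2) * ?A k3 * cnj (?A (k1 - k2 + k3)))"
      by (simp only: yg[OF w] complex_cnj_mult mult_ac)
    ultimately show "vec_at (dft (y \<omega>)) k1 * cnj (vec_at (dft (y \<omega>)) k2) *
          vec_at (dft (y \<omega>)) k3 * cnj (vec_at (dft (y \<omega>)) (k1 - k2 + k3)) =
        ?A k1 * cnj (?A k2) * ?A k3 * cnj (?A (k1 - k2 + k3))"
      by simp
  qed
  also have "\<dots> = K k1 k2 * K k3 (k1 - k2 + k3) + K k1 (k1 - k2 + k3) * K k3 k2"
    unfolding K_def by (rule isserlis_circ[OF c ind lam])
  also have "\<dots> = T_map S k1 k2 k3"
  proof -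
    \<comment> \<open>Isserlis yields \<open>K k3 (k1 - k2 + k3)\<close> and \<open>K k3 k2\<close>,
      whereas \<open>T_map\<close> has the conjugates of the transposed entries; Hermitian symmetry
      identifies them.\<close>
    have "cnj (K k m) = K m k" for k m by (simp add: K_def mult_ac)
    moreover have e: "k3 - k2 + k1 = k1 - k2 + k3" by simp
    ultimately show ?thesis by (simp add: T_map_def SK e)
  qed
  finally show "trispectrum M y k1 k2 k3 = T_map S k1 k2 k3" .
qed

section \<open>The matrices H and W\<close>

lemma sum_div_mod:
  fixes f :: "nat \<Rightarrow> nat \<Rightarrow> 'a :: comm_monoid_add"
  assumes "0 < n"
  shows "(\<Sum>q<m * n. f (q div n) (q mod n)) = (\<Sum>i<m. \<Sum>j<n. f i j)"
proof -
  have "(\<Sum>q<m * n. f (q div n) (q mod n)) = (\<Sum>(i, j)\<in>{..<m} \<times> {..<n}. f i j)"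
  proof (rule sum.reindex_bij_witness[where i = "\<lambda>(i, j). i * n + j" and j = "\<lambda>q. (q div n, q mod n)"])
    show "(\<lambda>(i, j). i * n + j) p \<in> {..<m * n}" if pmn: "p \<in> {..<m} \<times> {..<n}" for p
    proof -
      obtain i j where p: "p = (i, j)" "i < m" "j < n" using pmn by blast
      have "i * n + j < (i + 1) * n" using p by simp
      also have "\<dots> \<le> m * n" using p by (intro mult_right_mono) auto
      finally show ?thesis using p by simp
    qed
  qed (use assms in \<open>auto simp: less_mult_imp_div_less\<close>)
  then show ?thesis by (simp add: sum.cartesian_product)
qed

lemma sum_lessThan_add:
  fixes f :: "nat \<Rightarrow> 'a :: comm_monoid_add"
  shows "(\<Sum>t<m + n. f t) = (\<Sum>t<m. f t) + (\<Sum>t<n. f (m + t))"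
  by (induction n) (simp_all add: add.assoc)

lemma mat_at_int: "k < dim_row A \<Longrightarrow> m < dim_col A \<Longrightarrow> mat_at A (int k) (int m) = A $$ (k, m)"
  by (simp add: mat_at_def)

lemma mat_at_mod:
  assumes "A \<in> carrier_mat L L"
  shows "mat_at A (k mod int L) m = mat_at A k m" and "mat_at A k (m mod int L) = mat_at A k m"
  using assms by (simp_all add: mat_at_def)

lemma H_mat_index:
  assumes "A \<in> carrier_mat L L" and "k < L" and "m < L"
  shows "H_mat A i j $$ (k, m) = mat_at A (int k) (int m) * cnj (mat_at A (int k - i) (int m - j))"
  using assms by (simp add: H_mat_def hadamard_mat_def cyclic_shift_mat_def mat_at_int)

lemma H_mat_carrier: "A \<in> carrier_mat L L \<Longrightarrow> H_mat A i j \<in> carrier_mat L L"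
  by (simp add: H_mat_def hadamard_mat_def)

text \<open>Row \<open>k\<close> is the tensor product of \<open>b k\<close> with the conjugate of
  \<open>b (k - i)\<close>, its index pair being encoded by \<open>div\<close> and
  \<open>mod\<close>. This is the matrix called \<open>B_i\<close> in the outline.\<close>

definition shift_factor :: "nat \<Rightarrow> nat \<Rightarrow> (int \<Rightarrow> nat \<Rightarrow> complex) \<Rightarrow> int \<Rightarrow> complex mat" where
  "shift_factor L n b i = Matrix.mat L (n * n) (\<lambda>(k, q). b (int k) (q div n) * cnj (b (int k - i) (q mod n)))"

lemma shift_factor_carrier: "shift_factor L n b i \<in> carrier_mat L (n * n)"
  by (simp add: shift_factor_def)

text \<open>The inner product of tensor products is the product of the inner products, which is the
  mechanism behind the Schur product theorem. The two shifts may differ, so the off-diagonal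
  \<open>H_{i,i+1}\<close> is covered too.\<close>

lemma H_mat_eq_gram:
  assumes A: "A \<in> carrier_mat L L" and b: "\<And>k m. mat_at A k m = (\<Sum>q<n. b k q * cnj (b m q))"
    and n: "0 < n"
  shows "H_mat A i j = shift_factor L n b i * mat_adjoint (shift_factor L n b j)"
proof (rule eq_matI)
  fix k m
  assume "k < dim_row (shift_factor L n b i * mat_adjoint (shift_factor L n b j))"
    and "m < dim_col (shift_factor L n b i * mat_adjoint (shift_factor L n b j))"
  then have k: "k < L" and m: "m < L" by (simp_all add: shift_factor_def)
  have "(shift_factor L n b i * mat_adjoint (shift_factor L n b j)) $$ (k, m) =
      (\<Sum>q<n * n. b (int k) (q div n) * cnj (b (int k - i) (q mod n)) *
        (cnj (b (int m) (q div n)) * b (int m - j) (q mod n)))"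
    using k m by (simp add: shift_factor_def scalar_prod_def atLeast0LessThan)
  also have "\<dots> = (\<Sum>p<n. \<Sum>q<n. b (int k) p * cnj (b (int k - i) q) * (cnj (b (int m) p) * b (int m - j) q))"
    using n by (rule sum_div_mod)
  also have "\<dots> = mat_at A (int k) (int m) * cnj (mat_at A (int k - i) (int m - j))"
    by (simp add: b sum_product mult_ac)
  finally show "H_mat A i j $$ (k, m) = (shift_factor L n b i * mat_adjoint (shift_factor L n b j)) $$ (k, m)"
    using H_mat_index[OF A k m] by simp
qed (use H_mat_carrier[OF A] in \<open>auto simp: shift_factor_def\<close>)

text \<open>Inserting \<open>V * C\<close> and \<open>V' * D\<close> for the two shift factors into
  the Gram form puts \<open>V\<close> on the left and the adjoint of \<open>V'\<close> on the right;
  the middle factor is \<open>Q\<close>.\<close>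

lemma H_mat_factor_through:
  assumes A: "A \<in> carrier_mat L L" and b: "\<And>k m. mat_at A k m = (\<Sum>q<n. b k q * cnj (b m q))"
    and n: "0 < n" and k: "k < L" and m: "m < L"
    and V: "V \<in> carrier_mat L p" "V * (mat_adjoint V * shift_factor L n b i) = shift_factor L n b i"
    and V': "V' \<in> carrier_mat L p" "V' * (mat_adjoint V' * shift_factor L n b j) = shift_factor L n b j"
  defines "Q \<equiv> mat_adjoint V * shift_factor L n b i * mat_adjoint (mat_adjoint V' * shift_factor L n b j)"
  shows "H_mat A i j $$ (k, m) = (\<Sum>s<p. \<Sum>t<p. V $$ (k, s) * Q $$ (s, t) * cnj (V' $$ (m, t)))"
proof -
  define C where "C = mat_adjoint V * shift_factor L n b i"
  define D where "D = mat_adjoint V' * shift_factor L n b j"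
  have C: "C \<in> carrier_mat p (n * n)" and D: "D \<in> carrier_mat p (n * n)"
    unfolding C_def D_def
    by (rule mult_carrier_mat[OF mat_adjoint_carrier[OF V(1)] shift_factor_carrier]
        mult_carrier_mat[OF mat_adjoint_carrier[OF V'(1)] shift_factor_carrier])+
  have VC: "shift_factor L n b i = V * C" and VD: "shift_factor L n b j = V' * D"
    using V(2) V'(2) by (simp_all add: C_def D_def)
  have "H_mat A i j $$ (k, m) = (\<Sum>q<n * n. (V * C) $$ (k, q) * cnj ((V' * D) $$ (m, q)))"
    using k m V(1) V'(1) C D
    by (simp add: H_mat_eq_gram[OF A b n] VC VD scalar_prod_def[of "row (V * C) k"] atLeast0LessThan del: index_mult_mat(1))
      (simp add: scalar_prod_def atLeast0LessThan)
  also have "\<dots> = (\<Sum>q<n * n. \<Sum>s<p. \<Sum>t<p. V $$ (k, s) * (C $$ (s, q) * cnj (D $$ (t, q))) * cnj (V' $$ (m, t)))"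
    using k m V(1) V'(1) C D by (simp add: scalar_prod_def atLeast0LessThan sum_product mult_ac)
  also have "\<dots> = (\<Sum>s<p. \<Sum>q<n * n. \<Sum>t<p. V $$ (k, s) * (C $$ (s, q) * cnj (D $$ (t, q))) * cnj (V' $$ (m, t)))"
    by (rule sum.swap)
  also have "\<dots> = (\<Sum>s<p. \<Sum>t<p. \<Sum>q<n * n. V $$ (k, s) * (C $$ (s, q) * cnj (D $$ (t, q))) * cnj (V' $$ (m, t)))"
    by (intro sum.cong refl sum.swap)
  also have "\<dots> = (\<Sum>s<p. \<Sum>t<p. V $$ (k, s) * Q $$ (s, t) * cnj (V' $$ (m, t)))"
  proof (intro sum.cong refl)
    fix s t assume "s \<in> {..<p}" "t \<in> {..<p}"
    then have "Q $$ (s, t) = (\<Sum>q<n * n. C $$ (s, q) * cnj (D $$ (t, q)))"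
      using C D by (simp add: Q_def scalar_prod_def atLeast0LessThan flip: C_def D_def)
    then show "(\<Sum>q<n * n. V $$ (k, s) * (C $$ (s, q) * cnj (D $$ (t, q))) * cnj (V' $$ (m, t))) =
        V $$ (k, s) * Q $$ (s, t) * cnj (V' $$ (m, t))"
      by (simp add: sum_distrib_left sum_distrib_right)
  qed
  finally show ?thesis .
qed

section \<open>Entries of W and vectors in its kernel\<close>

lemma diag_block_mat_carrier_uniform:
  assumes "\<And>A. A \<in> set As \<Longrightarrow> A \<in> carrier_mat a b"
  shows "diag_block_mat As \<in> carrier_mat (length As * a) (length As * b)"
  using assms by (induction As) (auto simp: Let_def)

lemma diag_block_mat_index_uniform:
  fixes As :: "'a :: zero mat list"
  assumes "\<And>A. A \<in> set As \<Longrightarrow> A \<in> carrier_mat a b"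
    and "p < length As * a" and "q < length As * b"
  shows "diag_block_mat As $$ (p, q) =
    (if p div a = q div b then (As ! (p div a)) $$ (p mod a, q mod b) else 0)"
  using assms
proof (induction As arbitrary: p q)
  case (Cons A As)
  have A: "A \<in> carrier_mat a b" and As: "\<And>B. B \<in> set As \<Longrightarrow> B \<in> carrier_mat a b"
    using Cons.prems(1) by auto
  have D: "diag_block_mat As \<in> carrier_mat (length As * a) (length As * b)"
    using As by (rule diag_block_mat_carrier_uniform)
  have ab: "0 < a" "0 < b" using Cons.prems(2,3) by (auto intro: Nat.gr0I)
  have "diag_block_mat (A # As) $$ (p, q) =
      (if p < a then if q < b then A $$ (p, q) else 0
       else if q < b then 0 else diag_block_mat As $$ (p - a, q - b))"
    using Cons.prems(2,3) A D by (simp add: Let_def)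
  also have "\<dots> = (if p div a = q div b then ((A # As) ! (p div a)) $$ (p mod a, q mod b) else 0)"
  proof (cases "p < a \<or> q < b")
    case True
    then show ?thesis using ab by (auto simp: div_eq_0_iff)
  next
    case False
    then have pq: "p = (p - a) + a" "q = (q - b) + b" by auto
    have "p div a = Suc ((p - a) div a)" "p mod a = (p - a) mod a"
      "q div b = Suc ((q - b) div b)" "q mod b = (q - b) mod b"
      using ab by (subst pq, simp)+
    moreover have "diag_block_mat As $$ (p - a, q - b) =
        (if (p - a) div a = (q - b) div b then (As ! ((p - a) div a)) $$ ((p - a) mod a, (q - b) mod b) else 0)"
      using Cons.prems(2,3) False by (intro Cons.IH As) auto
    ultimately show ?thesis using False by simp
  qed
  finally show ?case .
qed simp

text \<open>Block \<open>i\<close> below the first \<open>L\<close> entries is \<open>vec (Q i)\<close>, with columns stacked as in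
  \<^const>\<open>vec_of_mat\<close>.\<close>

definition coupling_vec :: "nat \<Rightarrow> nat \<Rightarrow> (nat \<Rightarrow> complex) \<Rightarrow> (nat \<Rightarrow> complex mat) \<Rightarrow> complex vec" where
  "coupling_vec L p w Q = Matrix.vec (L + L * p\<^sup>2)
     (\<lambda>t. if t < L then w t else Q ((t - L) div p\<^sup>2) $$ (((t - L) mod p\<^sup>2) mod p, ((t - L) mod p\<^sup>2) div p))"

lemma W_mat_carrier:
  assumes S: "S \<in> carrier_mat L L" and V: "\<And>i. i < L \<Longrightarrow> V i \<in> carrier_mat L p"
  shows "W_mat S V \<in> carrier_mat (L ^ 3) (L + L * p\<^sup>2)"
proof -
  have "Z_mat L V i \<in> carrier_mat (L\<^sup>2) (p\<^sup>2)" if "i < L" for i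
    using V[OF that] V[of "(i + 1) mod L"] that by (simp add: Z_mat_def kronecker_mat_def power2_eq_square)
  then have Zs: "\<And>A. A \<in> set (map (Z_mat L V) [0..<L]) \<Longrightarrow> A \<in> carrier_mat (L\<^sup>2) (p\<^sup>2)" by auto
  from diag_block_mat_carrier_uniform[of "map (Z_mat L V) [0..<L]", OF Zs]
  have "diag_block_mat (map (Z_mat L V) [0..<L]) \<in> carrier_mat (L * L\<^sup>2) (L * p\<^sup>2)" by simp
  then show ?thesis
    using S by (intro carrier_matI) (simp_all add: W_mat_def hcat_mat_def M_mat_def Let_def power2_eq_square power3_eq_cube)
qed

text \<open>The conjugate of \<open>B\<close> Kronecker \<open>A\<close>, applied to a stacked
  \<open>Q\<close>, stacks \<open>A Q\<close> times the adjoint of \<open>B\<close>. So each row of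
  the product is one instance of the hypothesis \<open>eq\<close>: the \<open>M\<close> part gives
  its left side, and the block diagonal part subtracts its right side.\<close>

lemma W_mat_mult_coupling_vec:
  assumes S: "S \<in> carrier_mat L L" and V: "\<And>i. i < L \<Longrightarrow> V i \<in> carrier_mat L p"
    and p: "0 < p"
    and eq: "\<And>i k m. i < L \<Longrightarrow> k < L \<Longrightarrow> m < L \<Longrightarrow>
      H_mat S (int i) (int i + 1) $$ (k, m) * w (nat ((int m - int k) mod int L)) =
      (\<Sum>s<p. \<Sum>t<p. V i $$ (k, s) * Q i $$ (s, t) * cnj (V ((i + 1) mod L) $$ (m, t)))"
  shows "W_mat S V *\<^sub>v coupling_vec L p w Q = 0\<^sub>v (L ^ 3)"
proof (rule eq_vecI)
  let ?D = "diag_block_mat (map (Z_mat L V) [0..<L])"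
  have Z: "Z_mat L V i \<in> carrier_mat (L\<^sup>2) (p\<^sup>2)" if "i < L" for i
    using V[OF that] V[of "(i + 1) mod L"] that by (simp add: Z_mat_def kronecker_mat_def power2_eq_square)
  then have Zs: "\<And>A. A \<in> set (map (Z_mat L V) [0..<L]) \<Longrightarrow> A \<in> carrier_mat (L\<^sup>2) (p\<^sup>2)" by auto
  have D: "?D \<in> carrier_mat (L * L\<^sup>2) (L * p\<^sup>2)"
    using diag_block_mat_carrier_uniform[of "map (Z_mat L V) [0..<L]" "L\<^sup>2" "p\<^sup>2", OF Zs] by simp
  have Wc: "W_mat S V \<in> carrier_mat (L ^ 3) (L + L * p\<^sup>2)" using W_mat_carrier[OF S V] .
  fix x assume "x < dim_vec (0\<^sub>v (L ^ 3) :: complex vec)"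
  then have x: "x < L ^ 3" by simp
  then have L: "0 < L" by (auto intro: Nat.gr0I)
  \<comment> \<open>Row \<open>x\<close> lies in block row \<open>i\<close>. Columns are stacked
    inside the block, so the remainder modulo \<open>L\<close> is the row \<open>k\<close> and the
    quotient is the column \<open>m\<close>.\<close>
  define i where "i = x div L\<^sup>2"
  define x' where "x' = x mod L\<^sup>2"
  define k where "k = x' mod L"
  define m where "m = x' div L"
  have L3: "L ^ 3 = L * L\<^sup>2" by (simp add: power2_eq_square power3_eq_cube)
  have i: "i < L" using x by (simp add: i_def L3 less_mult_imp_div_less)
  have x'L: "x' < L * L" using L by (simp add: x'_def power2_eq_square)
  have k: "k < L" using L by (simp add: k_def)
  have m: "m < L" using x'L by (simp add: m_def less_mult_imp_div_less)
  let ?u = "coupling_vec L p w Q"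
  have W1: "W_mat S V $$ (x, t) = M_vec S i t $ x'" if "t < L" for t
    using that x S D by (simp add: W_mat_def hcat_mat_def M_mat_def Let_def i_def x'_def)
  have W2: "W_mat S V $$ (x, L + t) = - (if i = t div p\<^sup>2 then Z_mat L V i $$ (x', t mod p\<^sup>2) else 0)"
    if "t < L * p\<^sup>2" for t
  proof -
    have "W_mat S V $$ (x, L + t) = - (?D $$ (x, t))"
      using that x S D by (simp add: W_mat_def hcat_mat_def M_mat_def Let_def L3)
    also have "?D $$ (x, t) = (if x div L\<^sup>2 = t div p\<^sup>2 then (map (Z_mat L V) [0..<L] ! (x div L\<^sup>2)) $$ (x mod L\<^sup>2, t mod p\<^sup>2) else 0)"
      using that x by (intro diag_block_mat_index_uniform[OF Zs]) (auto simp: L3)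
    finally show ?thesis using i by (simp add: i_def x'_def)
  qed
  have M: "M_vec S i t $ x' = (if t = nat ((int m - int k) mod int L) then H_mat S (int i) (int i + 1) $$ (k, m) else 0)"
    if "t < L" for t
  proof -
    have "nat ((int m - int k) mod int L) < L" using L by (simp add: nat_less_iff)
    then show ?thesis
      using that x'L k m S H_mat_carrier[OF S, of "int i" "int i + 1"] L
      by (simp add: M_vec_def hadamard_vec_def vec_of_mat_def circulant_def vec_at_def flip: k_def m_def)
  qed
  \<comment> \<open>In the column index \<open>q\<close>, the quotient by \<open>p\<close> belongs
    to the conjugated outer factor and the remainder to the inner one, in agreement with the
    stacking in \<open>coupling_vec\<close>.\<close>
  have Zx: "Z_mat L V i $$ (x', q) = cnj (V ((i + 1) mod L) $$ (m, q div p)) * V i $$ (k, q mod p)"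
    if "q < p\<^sup>2" for q
  proof -
    have "V i \<in> carrier_mat L p" "V ((i + 1) mod L) \<in> carrier_mat L p"
      using V L i by simp_all
    moreover have "q div p < p" using that by (simp add: power2_eq_square less_mult_imp_div_less)
    ultimately show ?thesis
      using that x'L m by (simp add: Z_mat_def kronecker_mat_def power2_eq_square k_def m_def)
  qed
  have "(W_mat S V *\<^sub>v ?u) $ x = (\<Sum>t<L + L * p\<^sup>2. W_mat S V $$ (x, t) * ?u $ t)"
    using x Wc by (simp add: scalar_prod_def atLeast0LessThan coupling_vec_def)
  also have "\<dots> = (\<Sum>t<L. W_mat S V $$ (x, t) * ?u $ t) + (\<Sum>t<L * p\<^sup>2. W_mat S V $$ (x, L + t) * ?u $ (L + t))"
    by (rule sum_lessThan_add)
  also have "(\<Sum>t<L. W_mat S V $$ (x, t) * ?u $ t) = H_mat S (int i) (int i + 1) $$ (k, m) * w (nat ((int m - int k) mod int L))"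
  proof -
    have "(\<Sum>t<L. W_mat S V $$ (x, t) * ?u $ t) =
        (\<Sum>t<L. if t = nat ((int m - int k) mod int L) then H_mat S (int i) (int i + 1) $$ (k, m) * w t else 0)"
      by (intro sum.cong refl) (simp add: W1 M coupling_vec_def)
    then show ?thesis using L by (simp add: nat_less_iff)
  qed
  also have "(\<Sum>t<L * p\<^sup>2. W_mat S V $$ (x, L + t) * ?u $ (L + t)) =
      - (\<Sum>s<p. \<Sum>t<p. V i $$ (k, s) * Q i $$ (s, t) * cnj (V ((i + 1) mod L) $$ (m, t)))"
  proof -
    let ?f = "\<lambda>q. Z_mat L V i $$ (x', q) * Q i $$ (q mod p, q div p)"
    have "(\<Sum>t<L * p\<^sup>2. W_mat S V $$ (x, L + t) * ?u $ (L + t)) =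
        (\<Sum>t<L * p\<^sup>2. if t div p\<^sup>2 = i then - ?f (t mod p\<^sup>2) else 0)"
      by (intro sum.cong refl) (auto simp: W2 coupling_vec_def)
    also have "\<dots> = (\<Sum>j<L. \<Sum>q<p\<^sup>2. if j = i then - ?f q else 0)"
      using p by (intro sum_div_mod) simp
    also have "\<dots> = (\<Sum>j<L. if j = i then (\<Sum>q<p\<^sup>2. - ?f q) else 0)"
      by (intro sum.cong refl) simp
    also have "\<dots> = - (\<Sum>q<p\<^sup>2. ?f q)"
      using i by (simp add: sum_negf)
    also have "(\<Sum>q<p\<^sup>2. ?f q) = (\<Sum>q<p * p. cnj (V ((i + 1) mod L) $$ (m, q div p)) * V i $$ (k, q mod p) * Q i $$ (q mod p, q div p))"
      by (simp add: Zx power2_eq_square)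
    also have "\<dots> = (\<Sum>t<p. \<Sum>s<p. cnj (V ((i + 1) mod L) $$ (m, t)) * V i $$ (k, s) * Q i $$ (s, t))"
      using p by (rule sum_div_mod)
    also have "\<dots> = (\<Sum>s<p. \<Sum>t<p. V i $$ (k, s) * Q i $$ (s, t) * cnj (V ((i + 1) mod L) $$ (m, t)))"
      by (subst sum.swap) (simp add: mult_ac)
    finally show ?thesis .
  qed
  finally show "(W_mat S V *\<^sub>v ?u) $ x = 0\<^sub>v (L ^ 3) $ x"
    using eq[OF i k m] x by simp
qed (use W_mat_carrier[of S L V p, OF S V] in \<open>auto simp: coupling_vec_def\<close>)

section \<open>Recovery of the covariance\<close>

text \<open>For the last block, \<open>i = L - 1\<close>, the shift \<open>i + 1\<close> equals
  \<open>L\<close> while the matrix of eigenvectors wraps around to \<open>V 0\<close>; periodicity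
  of \<open>b\<close> reconciles the two.\<close>

lemma shift_factor_mod:
  assumes "\<And>k. b (k mod int L) = b k"
  shows "shift_factor L n b (i mod int L) = shift_factor L n b i"
proof -
  have "b (k - i mod int L) = b (k - i)" for k
    using assms[of "k - i mod int L"] assms[of "k - i"] by (simp add: mod_diff_right_eq)
  then show ?thesis by (simp add: shift_factor_def)
qed

lemma psd_mat_gram:
  assumes X: "X \<in> carrier_mat L L" and psd: "psd_mat X" and L: "0 < L"
  obtains b where "\<And>k m. mat_at X k m = (\<Sum>q<L. b k q * cnj (b m q))" "\<And>k. b (k mod int L) = b k"
proof -
  have herm: "X $$ (j, i) = cnj (X $$ (i, j))" if "i < L" "j < L" for i j
    using psd X that mat_adjoint_index[of j X i] by (simp add: psd_mat_def hermitian_mat_def)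
  have form: "0 \<le> Re (\<Sum>i<L. \<Sum>j<L. cnj (z i) * z j * X $$ (i, j))" for z
  proof -
    have "0 \<le> Re ((X *\<^sub>v Matrix.vec L z) \<bullet>c Matrix.vec L z)"
      using psd X by (auto simp: psd_mat_def)
    also have "(X *\<^sub>v Matrix.vec L z) \<bullet>c Matrix.vec L z = (\<Sum>i<L. \<Sum>j<L. cnj (z i) * z j * X $$ (i, j))"
      using X by (simp add: scalar_prod_def atLeast0LessThan sum_distrib_left mult_ac)
    finally show ?thesis .
  qed
  have "\<exists>Y. \<forall>i\<in>{..<L}. \<forall>j\<in>{..<L}. X $$ (i, j) = (\<Sum>q<L. Y i q * cnj (Y j q))"
    by (rule psd_kernel_factorization[OF finite_lessThan _ form]) (rule herm; simp)
  then obtain Y where Y: "X $$ (i, j) = (\<Sum>q<L. Y i q * cnj (Y j q))" if "i < L" "j < L" for i j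
    by blast
  show ?thesis
  proof
    fix k m
    have nat_less: "nat (k mod int L) < L" for k using L by (simp add: nat_less_iff)
    show "mat_at X k m = (\<Sum>q<L. Y (nat (k mod int L)) q * cnj (Y (nat (m mod int L)) q))"
      using X Y[OF nat_less nat_less] by (simp add: mat_at_def)
    show "(\<lambda>q. Y (nat (k mod int L mod int L)) q) = (\<lambda>q. Y (nat (k mod int L)) q)" by simp
  qed
qed

text \<open>A geometric progression that returns to 1 after \<open>L\<close> steps has an
  \<open>L\<close>-th root of unity as ratio. Hence \<open>c (m - k)\<close> splits into a phase
  depending on \<open>k\<close> and a conjugate phase depending on \<open>m\<close>, which is
  conjugation by a diagonal matrix.\<close>

lemma ambiguity_setI:
  assumes S: "S \<in> carrier_mat L L" and X: "X \<in> carrier_mat L L" and L: "0 < L"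
    and XS: "\<And>k m. mat_at X k m = c (m - k) * mat_at S k m"
    and c0: "c 0 = 1" and step: "\<And>n. c (n + 1) = \<omega> * c n" and cL: "c (int L) = 1"
  shows "X \<in> ambiguity_set S"
proof -
  have "c (int n) = \<omega> ^ n" for n
  proof (induction n)
    case (Suc n)
    then show ?case using step[of "int n"] by (simp add: add.commute)
  qed (simp add: c0)
  then have "\<omega> ^ L = 1" using cL by metis
  then have "\<omega> \<in> (\<lambda>k. cis (2 * pi * real k / real L)) ` {..<L}"
    using Complex.bij_betw_roots_unity[OF L] by (simp add: bij_betw_def)
  then obtain l where l: "l < L" "\<omega> = cis (2 * pi * real l / real L)" by auto
  have wl: "\<omega> * root_phase L (int l) = 1" by (simp add: l(2) root_phase_def cis_mult)
  have "c n * root_phase L (int l * n) = 1" for n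
  proof -
    \<comment> \<open>Powers of \<open>\<omega>\<close> describe \<open>c\<close> at natural numbers
      only. Constancy of this product reaches the negative arguments, which occur as
      \<open>m - k\<close>.\<close>
    have "c (n + 1) * root_phase L (int l * (n + 1)) = c n * root_phase L (int l * n)" for n
    proof -
      have "c (n + 1) * root_phase L (int l * (n + 1)) =
          (\<omega> * root_phase L (int l)) * (c n * root_phase L (int l * n))"
        by (simp only: step ring_distribs root_phase_add mult_1_left mult_1_right mult_ac)
      then show ?thesis by (simp only: wl mult_1_left)
    qed
    from int_constant_if_step[of "\<lambda>n. c n * root_phase L (int l * n)", OF this]
    show ?thesis by (simp add: c0)
  qed
  then have c: "c n = cnj (root_phase L (int l * n))" for n
    by (metis mult.assoc mult.right_neutral mult_1_left root_phase_mult_cnj)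
  have "X = mat_diag L (\<lambda>k. fourier_vec L l $ k) * S * mat_diag L (\<lambda>k. cnj (fourier_vec L l $ k))"
  proof (rule eq_matI)
    fix k m
    assume "k < dim_row (mat_diag L (\<lambda>k. fourier_vec L l $ k) * S * mat_diag L (\<lambda>k. cnj (fourier_vec L l $ k)))"
      "m < dim_col (mat_diag L (\<lambda>k. fourier_vec L l $ k) * S * mat_diag L (\<lambda>k. cnj (fourier_vec L l $ k)))"
    then have k: "k < L" and m: "m < L" using S by (simp_all add: mat_diag_def)
    have "X $$ (k, m) = cnj (root_phase L (int l * (int m - int k))) * S $$ (k, m)"
      using XS[of "int k" "int m"] X S k m by (simp add: mat_at_int c)
    also have "root_phase L (int l * (int m - int k)) =
        root_phase L (int m * int l) * cnj (root_phase L (int k * int l))"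
      by (simp only: right_diff_distrib root_phase_diff mult.commute)
    finally show "X $$ (k, m) = (mat_diag L (\<lambda>k. fourier_vec L l $ k) * S * mat_diag L (\<lambda>k. cnj (fourier_vec L l $ k))) $$ (k, m)"
      using S k m
      by (simp add: mat_diag_mult_left[of S L L] mat_diag_mult_right[of _ L L] fourier_vec_index)
  qed (use S X in \<open>auto simp: mat_diag_def\<close>)
  then show ?thesis using l(1) S by (auto simp: ambiguity_set_def Let_def)
qed

text \<open>Here \<open>\<bar>X 0 1\<bar>\<^sup>2 = X 0 0 * X 1 1\<close>, the equality case of Cauchy-Schwarz, so \<open>b 0\<close> and \<open>b 1\<close> are parallel.\<close>

lemma rank_one_phase_step:
  fixes S X :: "int \<Rightarrow> int \<Rightarrow> complex" and b :: "int \<Rightarrow> nat \<Rightarrow> complex"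
  assumes S: "\<And>k m. S k m = g k * cnj (g m)" and S0: "\<And>k m. S k m \<noteq> 0"
    and XS: "\<And>k m. X k m = c (m - k) * S k m" and c0: "c 0 = 1" and c1: "cmod (c 1) = 1"
    and b: "\<And>k m. X k m = (\<Sum>q<n. b k q * cnj (b m q))"
  shows "c (j + 1) = c 1 * c j"
proof -
  have cc: "c 1 * cnj (c 1) = 1" using c1 by (simp flip: complex_norm_square)
  have X10: "X 1 0 = cnj (X 0 1)" by (simp add: b mult.commute)
  have X00: "X 0 0 = g 0 * cnj (g 0)" and X11: "X 1 1 = g 1 * cnj (g 1)" and X01: "X 0 1 = c 1 * (g 0 * cnj (g 1))"
    using XS[of 0 0] XS[of 1 1] XS[of 0 1] c0 by (simp_all add: S)
  let ?e = "\<lambda>q. X 1 1 * b 0 q - X 0 1 * b 1 q"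
  have "(\<Sum>q<n. (\<alpha> * b 0 q - \<beta> * b 1 q) * cnj (\<alpha> * b 0 q - \<beta> * b 1 q)) =
      \<alpha> * cnj \<alpha> * X 0 0 - \<alpha> * cnj \<beta> * X 0 1 - \<beta> * cnj \<alpha> * X 1 0 + \<beta> * cnj \<beta> * X 1 1" for \<alpha> \<beta>
    by (simp add: b sum_distrib_left sum.distrib sum_subtractf algebra_simps)
  then have "(\<Sum>q<n. ?e q * cnj (?e q)) = X 1 1 * cnj (X 1 1) * X 0 0 - X 1 1 * cnj (X 0 1) * X 0 1
      - X 0 1 * cnj (X 1 1) * X 1 0 + X 0 1 * cnj (X 0 1) * X 1 1" .
  also have "\<dots> = 0"
  proof -
    have "X 0 1 * cnj (X 0 1) = X 0 0 * X 1 1"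
      using cc by (simp add: X00 X11 X01 algebra_simps)
    moreover have "cnj (X 1 1) = X 1 1" by (simp add: X11)
    ultimately show ?thesis by (simp add: X10 algebra_simps)
  qed
  finally have "complex_of_real (\<Sum>q<n. (cmod (?e q))\<^sup>2) = 0"
    by (simp add: complex_norm_square del: of_real_power)
  then have "(\<Sum>q<n. (cmod (?e q))\<^sup>2) = 0" by (simp only: of_real_eq_0_iff)
  then have "\<forall>q\<in>{..<n}. (cmod (?e q))\<^sup>2 = 0"
    by (subst (asm) sum_nonneg_eq_0_iff) auto
  then have e: "X 1 1 * b 0 q = X 0 1 * b 1 q" if "q < n" for q
    using that by simp
  \<comment> \<open>Pairing the parallel vectors \<open>b 0\<close> and \<open>b 1\<close> with
    \<open>b (j + 1)\<close> makes rows 0 and 1 of \<open>X\<close> proportional. Column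
    \<open>j + 1\<close> carries the phase \<open>c (j + 1)\<close> in row 0 and \<open>c j\<close>
    in row 1.\<close>
  have "X 1 1 * X 0 (j + 1) = X 0 1 * X 1 (j + 1)"
  proof -
    have "X 1 1 * X 0 (j + 1) = (\<Sum>q<n. (X 1 1 * b 0 q) * cnj (b (j + 1) q))"
      by (simp add: b[of 0 "j + 1"] sum_distrib_left mult_ac)
    also have "\<dots> = (\<Sum>q<n. (X 0 1 * b 1 q) * cnj (b (j + 1) q))"
      by (intro sum.cong refl) (simp add: e)
    also have "\<dots> = X 0 1 * X 1 (j + 1)"
      by (simp add: b[of 1 "j + 1"] sum_distrib_left mult_ac)
    finally show ?thesis .
  qed
  then have "S 0 1 * S 1 (j + 1) * c (j + 1) = S 0 1 * S 1 (j + 1) * (c 1 * c j)"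
    using XS[of 1 1] XS[of 0 "j + 1"] XS[of 0 1] XS[of 1 "j + 1"] c0 by (simp add: S mult_ac)
  then show ?thesis using S0 by simp
qed

text \<open>The factors \<open>f\<close> of \<open>S\<close> and \<open>b\<close> of
  \<open>X\<close> have different widths, \<open>r\<close> and \<open>L\<close>. The narrow one
  bounds the rank of \<open>H_{i,i}\<close> by the square of \<open>r\<close>; the wide one then
  inherits the range because both have the same Gram matrix.\<close>

lemma coupling_phase_step:
  assumes S: "S \<in> carrier_mat L L" and X: "X \<in> carrier_mat L L"
    and XS: "\<And>k m. mat_at X k m = c (m - k) * mat_at S k m"
    and c1: "\<And>n. cmod (c n) = 1" and cL: "\<And>n. c (n mod int L) = c n"
    and r: "0 < r" "r\<^sup>2 < L"
    and f: "\<And>k m. mat_at S k m = (\<Sum>q<r. f k q * cnj (f m q))" and f_mod: "\<And>k. f (k mod int L) = f k"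
    and b: "\<And>k m. mat_at X k m = (\<Sum>q<L. b k q * cnj (b m q))" and b_mod: "\<And>k. b (k mod int L) = b k"
    and top: "\<And>i. i < L \<Longrightarrow> top_eigenvectors (r\<^sup>2) (H_mat S (int i) (int i)) (V i)"
    and pos: "0 < second_smallest_singular_value (W_mat S V)"
  shows "\<exists>\<omega>. \<forall>n. c (n + 1) = \<omega> * c n"
proof -
  define p where "p = r * r"
  have pL: "p < L" and p0: "0 < p" and L: "0 < L" using r by (auto simp: p_def power2_eq_square)
  have cc: "c n * cnj (c n) = 1" for n using c1[of n] by (simp flip: complex_norm_square)
  have V: "V i \<in> carrier_mat L p" if "i < L" for i
    using top[OF that] H_mat_carrier[OF S, of "int i" "int i"]
    by (simp add: top_eigenvectors_def p_def power2_eq_square)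
  \<comment> \<open>Equal shifts of row and column preserve \<open>m - k\<close>, so the two phases
    in an entry are conjugate to each other and cancel.\<close>
  have HXS: "H_mat X i i = H_mat S i i" for i
  proof (rule eq_matI)
    fix k m assume "k < dim_row (H_mat S i i)" "m < dim_col (H_mat S i i)"
    then have km: "k < L" "m < L" using H_mat_carrier[OF S, of i i] by auto
    have "H_mat X i i $$ (k, m) = (c (int m - int k) * cnj (c (int m - int k))) * H_mat S i i $$ (k, m)"
      using km by (simp add: H_mat_index[OF X] H_mat_index[OF S] XS)
    then show "H_mat X i i $$ (k, m) = H_mat S i i $$ (k, m)" by (simp add: cc)
  qed (use H_mat_carrier[OF S, of i i] H_mat_carrier[OF X, of i i] in auto)
  have range_S: "V i * (mat_adjoint (V i) * shift_factor L r f (int i)) = shift_factor L r f (int i)"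
    and range_X: "V i * (mat_adjoint (V i) * shift_factor L L b (int i)) = shift_factor L L b (int i)"
    if "i < L" for i
  proof -
    have HS: "H_mat S (int i) (int i) = shift_factor L r f (int i) * mat_adjoint (shift_factor L r f (int i))"
      by (rule H_mat_eq_gram[OF S f r(1)])
    have HX: "H_mat S (int i) (int i) = shift_factor L L b (int i) * mat_adjoint (shift_factor L L b (int i))"
      unfolding HXS [symmetric] by (rule H_mat_eq_gram[OF X b L])
    have top': "top_eigenvectors (r * r) (shift_factor L r f (int i) * mat_adjoint (shift_factor L r f (int i))) (V i)"
      using top[OF that] by (simp add: HS power2_eq_square)
    show "V i * (mat_adjoint (V i) * shift_factor L r f (int i)) = shift_factor L r f (int i)"
      by (rule top_eigenvectors_gram_range[OF shift_factor_carrier shift_factor_carrier refl top'])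
    show "V i * (mat_adjoint (V i) * shift_factor L L b (int i)) = shift_factor L L b (int i)"
      by (rule top_eigenvectors_gram_range[OF shift_factor_carrier shift_factor_carrier _ top'])
        (simp only: HS [symmetric] HX [symmetric])
  qed
  have succ: "(i + 1) mod L < L" "int ((i + 1) mod L) = (int i + 1) mod int L" for i
    using L by (simp_all add: zmod_int add.commute)
  define QS where "QS i = mat_adjoint (V i) * shift_factor L r f (int i) *
      mat_adjoint (mat_adjoint (V ((i + 1) mod L)) * shift_factor L r f (int i + 1))" for i
  define QX where "QX i = mat_adjoint (V i) * shift_factor L L b (int i) *
      mat_adjoint (mat_adjoint (V ((i + 1) mod L)) * shift_factor L L b (int i + 1))" for i
  \<comment> \<open>The phase that \<open>H_{i,i+1}\<close> of \<open>X\<close> has relative to that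
    of \<open>S\<close>: shifting the column once more than the row lowers \<open>m - k\<close> by
    one in the conjugated factor.\<close>
  define w where "w t = c (int t) * cnj (c (int t - 1))" for t
  have "W_mat S V *\<^sub>v coupling_vec L p (\<lambda>_. 1) QS = 0\<^sub>v (L ^ 3)"
  proof (rule W_mat_mult_coupling_vec[OF S V p0])
    fix i k m assume i: "i < L" and k: "k < L" and m: "m < L"
    have 1: "V ((i + 1) mod L) * (mat_adjoint (V ((i + 1) mod L)) * shift_factor L r f (int i + 1)) = shift_factor L r f (int i + 1)"
      using range_S[OF succ(1), of i] unfolding succ(2) shift_factor_mod[where b = f and L = L, OF f_mod] .
    show "H_mat S (int i) (int i + 1) $$ (k, m) * 1 =
        (\<Sum>s<p. \<Sum>t<p. V i $$ (k, s) * QS i $$ (s, t) * cnj (V ((i + 1) mod L) $$ (m, t)))"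
      unfolding QS_def mult_1_right
      by (rule H_mat_factor_through[OF S f r(1) k m V[OF i] range_S[OF i] V[OF succ(1)] 1])
  qed
  moreover have "W_mat S V *\<^sub>v coupling_vec L p w QX = 0\<^sub>v (L ^ 3)"
  proof (rule W_mat_mult_coupling_vec[OF S V p0])
    fix i k m assume i: "i < L" and k: "k < L" and m: "m < L"
    have 1: "V ((i + 1) mod L) * (mat_adjoint (V ((i + 1) mod L)) * shift_factor L L b (int i + 1)) = shift_factor L L b (int i + 1)"
      using range_X[OF succ(1), of i] unfolding succ(2) shift_factor_mod[where b = b and L = L, OF b_mod] .
    let ?t = "nat ((int m - int k) mod int L)"
    have "w ?t = c (int m - int k) * cnj (c (int m - int k - 1))"
    proof -
      have "int ?t = (int m - int k) mod int L" using L by simp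
      moreover have "c ((int m - int k) mod int L - 1) = c (int m - int k - 1)"
        using cL[of "(int m - int k) mod int L - 1"] cL[of "int m - int k - 1"] by (simp add: mod_diff_left_eq)
      ultimately show ?thesis by (simp only: w_def cL)
    qed
    then have "H_mat S (int i) (int i + 1) $$ (k, m) * w ?t = H_mat X (int i) (int i + 1) $$ (k, m)"
      using k m by (simp add: H_mat_index[OF X] H_mat_index[OF S] XS algebra_simps)
    also have "\<dots> = (\<Sum>s<p. \<Sum>t<p. V i $$ (k, s) * QX i $$ (s, t) * cnj (V ((i + 1) mod L) $$ (m, t)))"
      unfolding QX_def
      by (rule H_mat_factor_through[OF X b L k m V[OF i] range_X[OF i] V[OF succ(1)] 1])
    finally show "H_mat S (int i) (int i + 1) $$ (k, m) * w ?t =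
        (\<Sum>s<p. \<Sum>t<p. V i $$ (k, s) * QX i $$ (s, t) * cnj (V ((i + 1) mod L) $$ (m, t)))" .
  qed
  moreover have "coupling_vec L p (\<lambda>_. 1) QS \<noteq> 0\<^sub>v (L + L * p\<^sup>2)"
  proof
    assume "coupling_vec L p (\<lambda>_. 1) QS = 0\<^sub>v (L + L * p\<^sup>2)"
    then have "coupling_vec L p (\<lambda>_. 1) QS $ 0 = (0\<^sub>v (L + L * p\<^sup>2) :: complex vec) $ 0" by simp
    then show False using L by (simp add: coupling_vec_def)
  qed
  \<comment> \<open>\<open>W\<close> is at least as tall as wide, by \<open>p < L\<close>. Its
    singular values therefore come from \<open>mat_adjoint W * W\<close>, whose kernel is that of
    \<open>W\<close>.\<close>
  moreover have "L + L * p\<^sup>2 \<le> L ^ 3"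
  proof -
    have "1 + p\<^sup>2 \<le> (p + 1)\<^sup>2" by (simp add: power2_eq_square)
    also have "\<dots> \<le> L\<^sup>2" using pL by (intro power_mono) auto
    finally have "L * (1 + p\<^sup>2) \<le> L * L\<^sup>2" by (rule mult_le_mono2)
    moreover have "L ^ 3 = L * L\<^sup>2" by (simp add: power2_eq_square power3_eq_cube)
    ultimately show ?thesis by (simp only: ring_distribs mult_1_right)
  qed
  moreover have "2 \<le> L + L * p\<^sup>2"
  proof -
    have "1 \<le> L * p\<^sup>2" using L p0 by (simp add: Suc_le_eq)
    then show ?thesis using L by linarith
  qed
  \<comment> \<open>Both kernel vectors lie in a one-dimensional space, so \<open>w\<close> is proportional to the all-ones vector.\<close>
  ultimately obtain \<omega> where u: "coupling_vec L p w QX = \<omega> \<cdot>\<^sub>v coupling_vec L p (\<lambda>_. 1) QS"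
    using singular_value_kernel_unique[OF W_mat_carrier[OF S V] _ _ pos, of "coupling_vec L p (\<lambda>_. 1) QS" "coupling_vec L p w QX"]
    by (auto simp: coupling_vec_def)
  have w: "w t = \<omega>" if "t < L" for t
  proof -
    have "coupling_vec L p w QX $ t = (\<omega> \<cdot>\<^sub>v coupling_vec L p (\<lambda>_. 1) QS) $ t" by (simp only: u)
    then show ?thesis using that by (simp add: coupling_vec_def)
  qed
  have "c (n + 1) = \<omega> * c n" for n
  proof -
    define t where "t = nat ((n + 1) mod int L)"
    have t: "int t = (n + 1) mod int L" "t < L" using L by (simp_all add: t_def nat_less_iff)
    have "c ((n + 1) mod int L - 1) = c n"
      using cL[of "(n + 1) mod int L - 1"] cL[of n] by (simp add: mod_diff_left_eq)
    then have "\<omega> = c (n + 1) * cnj (c n)"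
      using w[OF t(2)] by (simp only: w_def t(1) cL)
    then have "\<omega> * c n = c (n + 1) * (c n * cnj (c n))" by simp
    then show ?thesis by (simp add: cc)
  qed
  then show ?thesis by blast
qed

lemma T_map_mod:
  assumes "A \<in> carrier_mat L L"
  shows "T_map A (k1 mod int L) (k2 mod int L) (k3 mod int L) = T_map A k1 k2 k3"
proof -
  have "(k3 mod int L - k2 mod int L + k1 mod int L) mod int L = (k3 - k2 + k1) mod int L"
    by (intro mod_add_cong mod_diff_cong) simp_all
  then show ?thesis using assms by (simp add: T_map_def mat_at_def)
qed

theorem theorem5:
  fixes M :: "'w measure" and L r :: nat
    and v :: "nat \<Rightarrow> complex vec" and lam :: "nat \<Rightarrow> real"
    and a :: "nat \<Rightarrow> 'w \<Rightarrow> complex" and s :: "'w \<Rightarrow> nat"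
    and x y :: "'w \<Rightarrow> complex vec"
    and S X :: "complex mat" and V :: "nat \<Rightarrow> complex mat"
  assumes "prob_space M"
    and "0 < L"
    and "\<And>i. i < r \<Longrightarrow> v i \<in> carrier_vec L"
    and "\<And>i j. i < r \<Longrightarrow> j < r \<Longrightarrow> v i \<bullet>c v j = (if i = j then 1 else 0)"
    and "\<And>i. i < r \<Longrightarrow> 0 < lam i"
    and "\<And>i. i < r \<Longrightarrow> circ_complex_normal M (lam i) (a i)"
    and "prob_space.indep_vars M (\<lambda>_. borel) a {..<r}"
    and x_def: "\<And>\<omega>. \<omega> \<in> space M \<Longrightarrow> x \<omega> = Matrix.vec L (\<lambda>l. \<Sum>i<r. a i \<omega> * v i $ l)"
    and "independent_rvs M
           (count_space {..<L}) s
           (\<Pi>\<^sub>M l\<in>{..<L}. borel) (\<lambda>\<omega>. \<lambda>l\<in>{..<L}. x \<omega> $ l)"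
    and y_def: "\<And>\<omega>. \<omega> \<in> space M \<Longrightarrow> y \<omega> = cyclic_shift (s \<omega>) (x \<omega>)"
    and S_def: "S = covariance_dft M L x"
    and "\<And>i j. i < L \<Longrightarrow> j < L \<Longrightarrow> S $$ (i, j) \<noteq> 0"
    and "\<And>i. 1 < r \<Longrightarrow> real r < sqrt (real L) \<Longrightarrow> i < L \<Longrightarrow>
           top_eigenvectors (r\<^sup>2) (H_mat S (int i) (int i)) (V i)"
    and "r = 1 \<or>
         (1 < r \<and> real r < sqrt (real L) \<and> 0 < second_smallest_singular_value (W_mat S V))"
    and "X \<in> carrier_mat L L"
    and "hermitian_mat X"
    and "psd_mat X"
    and "\<And>k. k \<in> {0..<int L} \<Longrightarrow> power_spectrum M y k = P_map X k"
    and "\<And>k1 k2 k3. k1 \<in> {0..<int L} \<Longrightarrow> k2 \<in> {0..<int L} \<Longrightarrow> k3 \<in> {0..<int L} \<Longrightarrow>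
           trispectrum M y k1 k2 k3 = T_map X k1 k2 k3"
  shows "X \<in> ambiguity_set S"
proof -
  interpret prob_space M by (rule assms(1))
  note L = assms(2) and v = assms(3) and lam = assms(5) and circ = assms(6) and ind = assms(7)
  note S0 = assms(12) and X = assms(15) and psd = assms(17)
  have spec: "mat_at S k m = (\<Sum>i<r. of_real (lam i) * vec_at (dft (v i)) k * cnj (vec_at (dft (v i)) m))"
      "power_spectrum M y k = P_map S k" "trispectrum M y k1 k2 k3 = T_map S k1 k2 k3" for k m k1 k2 k3
  proof -
    note * = spectra_of_shifted_signal[where L = L and r = r and v = v and lam = lam and a = a
        and x = x and y = y and s = s, OF L v lam circ ind x_def y_def, folded S_def]
    show "mat_at S k m = (\<Sum>i<r. of_real (lam i) * vec_at (dft (v i)) k * cnj (vec_at (dft (v i)) m))"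
      by (rule *(1))
    show "power_spectrum M y k = P_map S k" by (rule *(2))
    show "trispectrum M y k1 k2 k3 = T_map S k1 k2 k3" by (rule *(3))
  qed
  have S: "S \<in> carrier_mat L L" by (simp add: S_def covariance_dft_def)
  have S_nz: "mat_at S k m \<noteq> 0" for k m
    using S0 S L by (simp add: mat_at_def nat_less_iff)
  \<comment> \<open>The spectra are compared on one period of frequencies only; both maps are
    periodic, which extends the equality to all integers.\<close>
  have T: "T_map X k1 k2 k3 = T_map S k1 k2 k3" for k1 k2 k3
  proof -
    have "k mod int L \<in> {0..<int L}" for k using L by simp
    from assms(19)[OF this this this, of k1 k2 k3] show ?thesis
      unfolding spec(3) T_map_mod[OF X] T_map_mod[OF S] by simp
  qed
  have diag: "mat_at X k k = mat_at S k k" for k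
  proof -
    have "k mod int L \<in> {0..<int L}" using L by simp
    from assms(18)[OF this] have "P_map X (k mod int L) = P_map S (k mod int L)"
      unfolding spec(2) by simp
    then show ?thesis by (simp add: P_map_def mat_at_mod[OF X] mat_at_mod[OF S])
  qed
  define c where "c m = mat_at X 0 m / mat_at S 0 m" for m
  note phase = equal_trispectrum_imp_phase_per_diagonal[of "mat_at S" "mat_at X", OF S_nz diag
      T[unfolded T_map_def], folded c_def]
  have c0: "c 0 = 1" using diag[of 0] S_nz by (simp add: c_def)
  have c_mod: "c (n mod int L) = c n" for n
    using mat_at_mod[OF X] mat_at_mod[OF S] by (simp add: c_def)
  obtain b where b: "\<And>k m. mat_at X k m = (\<Sum>q<L. b k q * cnj (b m q))"
    and b_mod: "\<And>k. b (k mod int L) = b k"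
    using psd_mat_gram[OF X psd L] by blast
  \<comment> \<open>Square roots of the variances make this a Gram factor of \<open>S\<close>. The
    index is reduced explicitly so that periodicity holds for every \<open>i\<close>, including
    \<open>i \<ge> r\<close>, where the dimension of \<open>v i\<close> is unknown.\<close>
  define f where "f k i = complex_of_real (sqrt (lam i)) * vec_at (dft (v i)) (k mod int L)" for k i
  have dim: "dim_vec (v i) = L" if "i < r" for i using v[OF that] by simp
  have f: "mat_at S k m = (\<Sum>i<r. f k i * cnj (f m i))" for k m
    unfolding spec(1)
  proof (intro sum.cong refl)
    fix i assume i: "i \<in> {..<r}"
    have "complex_of_real (lam i) = complex_of_real (sqrt (lam i)) * complex_of_real (sqrt (lam i))"
      using lam[of i] i by (simp flip: of_real_mult)
    then show "of_real (lam i) * vec_at (dft (v i)) k * cnj (vec_at (dft (v i)) m) = f k i * cnj (f m i)"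
      using dim[of i] i by (simp add: f_def vec_at_def mult_ac)
  qed
  have f_mod: "f (k mod int L) = f k" for k by (simp add: f_def fun_eq_iff)
  have "\<exists>\<omega>. \<forall>n. c (n + 1) = \<omega> * c n"
  proof (cases "r = 1")
    case True
    have "mat_at S k m = f k 0 * cnj (f m 0)" for k m using f[of k m] True by simp
    from rank_one_phase_step[of "mat_at S", OF this S_nz phase(1) c0 phase(2) b]
    show ?thesis by blast
  next
    case False
    then have r: "1 < r" "real r < sqrt (real L)" and pos: "0 < second_smallest_singular_value (W_mat S V)"
      using assms(14) by auto
    have "(real r)\<^sup>2 < (sqrt (real L))\<^sup>2"
      using r(2) by (intro power_strict_mono) simp_all
    then have "real (r\<^sup>2) < real L" by simp
    then have rL: "r\<^sup>2 < L" by (simp only: of_nat_less_iff)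
    have r0: "0 < r" using r(1) by simp
    show ?thesis
      by (rule coupling_phase_step[OF S X phase(1) phase(2) c_mod r0 rL f f_mod b b_mod assms(13)[OF r] pos])
  qed
  then obtain \<omega> where step: "\<And>n. c (n + 1) = \<omega> * c n" by blast
  have cL: "c (int L) = 1" using c_mod[of "int L"] c0 by simp
  show ?thesis
    by (rule ambiguity_setI[OF S X L phase(1) c0 step cL])
qed

end
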